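(* Let $k$ be a field of characteristic $0$ and $s\ge1$. For every $f\in k^{\mathbb{N}}$ (i.e. $f\in k\langle\langle x_1,\dots,x_s\rangle\rangle_+$, coordinates indexed by the countable set of non-empty words), the $\boxplus_V$-cumulants $\operatorname{LOG}_{\boxplus_V}(f)$ and the free cumulants $\kappa(f)=\mathcal{R}(f)$ are related by a linear transformation, given by a lower-triangular matrix with unit diagonal, namely $$\mathcal{R}=d\mathcal{R}\circ\operatorname{LOG}_{\boxplus_V},$$ where $\mathcal{R}(f)=f\boxtimes\operatorname{Moeb}$ is the $\mathcal{R}$-transform and $d\mathcal{R}$ is its differential evaluated at the identity $0$ of the group $(k^{\mathbb{N}},\boxplus_V,0)$.
   Context: $k\langle\langle x_1,\dots,x_s\rangle\rangle_+$: formal power series in non-commuting variables without constant term; $f_w$ is the coefficient of $x_w=x_{i_1}\cdots x_{i_n}$, $w=(i_1\dots i_n)$, $|w|=n$. Words are ordered by length and then lexicographically. Boxed convolution: $(f\boxtimes g)_w=\sum_{\pi\in \mathrm{NC}(|w|)}f_{w,\pi}\,g_{w,K(\pi)}$, where $\mathrm{NC}(n)$ is the set of non-crossing partitions of $\{1,\dots,n\}$, $K(\pi)$ the Kreweras complement, $f_{w,\pi}=\prod_{V\in\pi}f_{w|V}$, and $w|V=(i_{v_1}\dots i_{v_m})$ for $V=\{v_1<\dots<v_m\}$. The series with first-order coefficients invertible form a group under $\boxtimes$ with unit $x_1+\dots+x_s$; $\operatorname{Zeta}$ is the series all of whose coefficients (at non-empty words) equal $1$, and $\operatorname{Moeb}$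 is its $\boxtimes$-inverse. The $|w|$th free cumulant is $\kappa_w(f)=(f\boxtimes\operatorname{Moeb})_w$. Free additive convolution: $f\boxplus_V g:=(f\bullet_{\mathrm F}g)\circ\Delta_a$, with $f$ identified with a linear functional on polynomials without constant term via $f(x_w)=f_w$, $\Delta_a(x_i)=x_i+y_i$ extended multiplicatively, and $f\bullet_{\mathrm F} g$ the free product functional on $k\langle x_1,\dots,x_s,y_1,\dots,y_s\rangle_+$: for a product $a_1\cdots a_m$ alternating between polynomials in the $x$'s ($\epsilon_i=1$) and in the $y$'s ($\epsilon_i=2$), recursively $f\bullet_{\mathrm F}g(a_1\cdots a_m)=\sum_{I\subsetneq\{1,\dots,m\}}(-1)^{m-|I|+1}f\bullet_{\mathrm F}g(\prod_{i\in I}a_i)\prod_{i\notin I}\varphi_{\epsilon_i}(a_i)$, $\varphi_1=f$, $\varphi_2=g$, with value $1$ on the empty product and equal to $f$ (resp. $g$) on $x$-polynomials (resp. $y$-polynomials). $\boxplus_V$ is a polynomial abelian group law with unit $0$. $\operatorname{LOG}_{\boxplus_V}$ is the logarithm in Jacobian coordinates: for the group law $\circ=\boxplus_V$ let $L_x(y)=x\circ y$ and let $J_{L_x}(0)$ be the Jacobian matrix of $L_x$ at $y=0$; $\operatorname{EXP}(\xi):=\gamma(1)$, where $\gamma$ is the unique curve, polynomial in each coordinate, with $\gamma(0)=0$, $\gamma'(t)=J_{L_{\gamma(t)}}(0)\xi$; and $\operatorname{LOG}:=\operatorname{EXP}^{-1}$. *)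

theory Defs
  imports
    "HOL-Library.Poly_Mapping"
    "HOL-Library.Disjoint_Sets"
    "HOL-Computational_Algebra.Polynomial"
begin

section \<open>Series and polynomials in non-commuting variables\<close>

text \<open>
  Words over the alphabet \<^typ>\<open>'s\<close> are lists. A formal power series without constant term is its
  coefficient family \<open>w \<mapsto> f w\<close>, with coefficient \<open>0\<close> at the empty word; all coordinates proper are
  indexed by the non-empty words.
\<close>

definition ncseries :: "('s list \<Rightarrow> 'k::zero) set" where
  "ncseries = {f. f [] = 0}"

text \<open>
  Lists form the free monoid, written additively, so that the finitely supported functions
  \<open>'a list \<Rightarrow>\<^sub>0 'k\<close> with the convolution product of \<^theory>\<open>HOL-Library.Poly_Mapping\<close> are the
  polynomials in the non-commuting variables \<^typ>\<open>'a\<close>.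
\<close>

instantiation list :: (type) monoid_add
begin

definition zero_list :: "'a list" where "zero_list = []"

definition plus_list :: "'a list \<Rightarrow> 'a list \<Rightarrow> 'a list" where "plus_list u v = u @ v"

instance by standard (simp_all add: zero_list_def plus_list_def)

end

type_synonym ('a, 'k) ncpoly = "'a list \<Rightarrow>\<^sub>0 'k"

definition ncvar :: "'a \<Rightarrow> ('a, 'k::zero_neq_one) ncpoly" where
  "ncvar a = Poly_Mapping.single [a] 1"

text \<open>The linear functional with prescribed values on the basis of words.\<close>

definition functional :: "('a list \<Rightarrow> 'k) \<Rightarrow> ('a, 'k) ncpoly \<Rightarrow> 'k::comm_ring_1" where
  "functional \<phi> p = (\<Sum>u\<in>Poly_Mapping.keys p. Poly_Mapping.lookup p u * \<phi> u)"


section \<open>Boxed convolution\<close>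

definition noncrossing :: "nat set set \<Rightarrow> bool" where
  "noncrossing P \<longleftrightarrow>
     (\<forall>V\<in>P. \<forall>W\<in>P. V \<noteq> W \<longrightarrow>
        \<not> (\<exists>a\<in>V. \<exists>b\<in>W. \<exists>c\<in>V. \<exists>d\<in>W. a < b \<and> b < c \<and> c < d))"

text \<open>Positions in a word of length \<open>n\<close> are counted from \<open>0\<close>.\<close>

definition NC :: "nat \<Rightarrow> nat set set set" where
  "NC n = {P. partition_on {..<n} P \<and> noncrossing P}"

text \<open>
  The Kreweras complement of \<open>P\<close> is the coarsest \<open>Q\<close> such that \<open>P\<close> and \<open>Q\<close> together
  are non-crossing on the interlaced points \<open>0 < 0' < 1 < 1' < \<dots>\<close>, where \<open>P\<close> lives on the
  points \<open>i\<close> (encoded as \<open>2 * i\<close>) and \<open>Q\<close> on the points \<open>i'\<close> (encoded as \<open>2 * i + 1\<close>).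
\<close>

definition interlace :: "nat set set \<Rightarrow> nat set set \<Rightarrow> nat set set" where
  "interlace P Q = (`) (\<lambda>i. 2 * i) ` P \<union> (`) (\<lambda>i. 2 * i + 1) ` Q"

definition kreweras :: "nat \<Rightarrow> nat set set \<Rightarrow> nat set set" where
  "kreweras n P = (THE Q. Q \<in> NC n \<and> noncrossing (interlace P Q) \<and>
     (\<forall>Q'\<in>NC n. noncrossing (interlace P Q') \<longrightarrow> refines {..<n} Q' Q))"

definition coeff_part :: "('s list \<Rightarrow> 'k::comm_ring_1) \<Rightarrow> 's list \<Rightarrow> nat set set \<Rightarrow> 'k" where
  "coeff_part f w P = (\<Prod>V\<in>P. f (nths w V))"

definition boxconv ::
    "('s list \<Rightarrow> 'k::comm_ring_1) \<Rightarrow> ('s list \<Rightarrow> 'k) \<Rightarrow> 's list \<Rightarrow> 'k" (infixl "\<boxtimes>" 70) where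
  "(f \<boxtimes> g) w = (if w = [] then 0
     else \<Sum>P\<in>NC (length w). coeff_part f w P * coeff_part g w (kreweras (length w) P))"

definition boxunit :: "'s list \<Rightarrow> 'k::comm_ring_1" where
  "boxunit w = (if length w = 1 then 1 else 0)"

definition boxgroup :: "('s list \<Rightarrow> 'k::field) set" where
  "boxgroup = {f \<in> ncseries. \<forall>i. f [i] \<noteq> 0}"

definition Zeta :: "'s list \<Rightarrow> 'k::comm_ring_1" where
  "Zeta w = (if w = [] then 0 else 1)"

definition Moeb :: "'s list \<Rightarrow> 'k::field" where
  "Moeb = (THE g. g \<in> boxgroup \<and> Zeta \<boxtimes> g = boxunit \<and> g \<boxtimes> Zeta = boxunit)"

definition R_transform :: "('s list \<Rightarrow> 'k::field) \<Rightarrow> 's list \<Rightarrow> 'k" where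
  "R_transform f = f \<boxtimes> Moeb"


section \<open>Free additive convolution\<close>

text \<open>
  The variables \<open>x\<^sub>i\<close> and \<open>y\<^sub>i\<close> are the letters \<^term>\<open>Inl i\<close> and \<^term>\<open>Inr i\<close>. The function
  \<open>runs\<close> is the factorization of a monomial into maximal blocks of \<open>x\<close>'s and of \<open>y\<close>'s, i.e. its
  presentation as an alternating product.
\<close>

function runs :: "('s + 's) list \<Rightarrow> ('s + 's) list list" where
  "runs [] = []"
| "runs (z # u) =
     (z # takeWhile (\<lambda>y. isl y = isl z) u) # runs (dropWhile (\<lambda>y. isl y = isl z) u)"
  by pat_completeness auto
termination
  by (relation "measure length") (simp_all add: length_dropWhile_le le_imp_less_Suc)

text \<open>\<open>marginal f g\<close> is \<open>\<phi>\<^sub>1 = f\<close> on words in the \<open>x\<close>'s and \<open>\<phi>\<^sub>2 = g\<close> on words in the \<open>y\<close>'s.\<close>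

definition marginal ::
    "('s list \<Rightarrow> 'k) \<Rightarrow> ('s list \<Rightarrow> 'k) \<Rightarrow> ('s + 's) list \<Rightarrow> 'k" where
  "marginal f g u = (if isl (hd u) then f (map projl u) else g (map projr u))"

lemma runs_nonempty: "[] \<notin> set (runs u)"
  by (induction u rule: runs.induct) auto

lemma concat_runs: "concat (runs u) = u"
  by (induction u rule: runs.induct) auto

lemma length_concat_nths_less:
  assumes "[] \<notin> set xs" "I \<subset> {..<length xs}"
  shows "length (concat (nths xs I)) < length (concat xs)"
  using assms
proof (induction xs arbitrary: I)
  case Nil
  then show ?case by auto
next
  case (Cons x xs)
  let ?J = "{j. Suc j \<in> I}"
  have J: "?J \<subseteq> {..<length xs}"
    using Cons.prems(2) by auto
  have le: "length (concat (nths xs ?J)) \<le> length (concat xs)"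
  proof (cases "?J = {..<length xs}")
    case True
    then show ?thesis by (simp add: nths_all)
  next
    case False
    with J Cons show ?thesis by (simp add: less_imp_le psubset_eq)
  qed
  show ?case
  proof (cases "0 \<in> I")
    case True
    have "?J \<noteq> {..<length xs}"
    proof
      assume eq: "?J = {..<length xs}"
      have "i \<in> I" if "i < length (x # xs)" for i
        using that True eq by (cases i) auto
      with Cons.prems(2) show False by auto
    qed
    with J Cons True show ?thesis by (simp add: nths_Cons psubset_eq)
  next
    case False
    with le Cons.prems(1) show ?thesis by (cases x) (simp_all add: nths_Cons)
  qed
qed

text \<open>
  The free product functional on monomials, by the recursion for its alternating factorization
  \<open>a\<^sub>0 \<dots> a\<^sub>m\<^sub>-\<^sub>1\<close>. Both sides of the recursion are multilinear in the factors, so this determines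
  the functional; the recursion for alternating products of arbitrary polynomials is
  \<open>freeprod_alternating\<close> below, and \<open>freeprod_marginal\<close> gives the restrictions to the
  \<open>x\<close>-polynomials and to the \<open>y\<close>-polynomials.
\<close>

function freeprod ::
    "('s list \<Rightarrow> 'k::comm_ring_1) \<Rightarrow> ('s list \<Rightarrow> 'k) \<Rightarrow> ('s + 's) list \<Rightarrow> 'k" where
  "freeprod f g u = (if u = [] then 1 else
     (\<Sum>I\<in>{I. I \<subset> {..<length (runs u)}}.
        (-1) ^ (length (runs u) - card I + 1) * freeprod f g (concat (nths (runs u) I)) *
        (\<Prod>i\<in>{..<length (runs u)} - I. marginal f g (runs u ! i))))"
  by pat_completeness auto
termination
proof (relation "measure (\<lambda>(f, g, u). length u)", goal_cases)
  case (2 f g u I)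
  then show ?case
    using length_concat_nths_less[OF runs_nonempty[of u], of I] by (simp add: concat_runs)
qed simp

declare freeprod.simps [simp del]

text \<open>The algebra homomorphism with \<open>x\<^sub>i \<mapsto> x\<^sub>i + y\<^sub>i\<close>, on monomials \<open>x\<^sub>w\<close>.\<close>

definition Delta_a :: "'s list \<Rightarrow> ('s + 's, 'k::comm_ring_1) ncpoly" where
  "Delta_a w = prod_list (map (\<lambda>i. ncvar (Inl i) + ncvar (Inr i)) w)"

definition boxplus ::
    "('s list \<Rightarrow> 'k::comm_ring_1) \<Rightarrow> ('s list \<Rightarrow> 'k) \<Rightarrow> 's list \<Rightarrow> 'k" (infixl "\<boxplus>" 65) where
  "(f \<boxplus> g) w = (if w = [] then 0 else functional (freeprod f g) (Delta_a w))"


section \<open>Formal differential calculus and the logarithm of a group law\<close>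

text \<open>
  Partial derivative of a function \<open>F\<close> that is polynomial in the coordinate \<open>v\<close>, at the point \<open>a\<close>.
  As \<^typ>\<open>'k\<close> is infinite, the polynomial \<open>p\<close> is unique.
\<close>

definition partial_deriv :: "(('i \<Rightarrow> 'k) \<Rightarrow> 'k) \<Rightarrow> ('i \<Rightarrow> 'k) \<Rightarrow> 'i \<Rightarrow> 'k::field_char_0" where
  "partial_deriv F a v = poly (pderiv (THE p. \<forall>t. poly p t = F (a(v := t)))) (a v)"

definition jacobian ::
    "(('i \<Rightarrow> 'k) \<Rightarrow> 'j \<Rightarrow> 'k) \<Rightarrow> ('i \<Rightarrow> 'k) \<Rightarrow> 'j \<Rightarrow> 'i \<Rightarrow> 'k::field_char_0" where
  "jacobian F a w v = partial_deriv (\<lambda>y. F y w) a v"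

text \<open>Matrix times vector, for matrices with finitely many non-zero entries in each row.\<close>

definition mat_apply :: "('j \<Rightarrow> 'i \<Rightarrow> 'k) \<Rightarrow> ('i \<Rightarrow> 'k) \<Rightarrow> 'j \<Rightarrow> 'k::comm_ring_1" where
  "mat_apply M \<xi> w = (\<Sum>v | M w v \<noteq> 0. M w v * \<xi> v)"

definition zero_series :: "'s list \<Rightarrow> 'k::zero" where
  "zero_series = (\<lambda>w. 0)"

text \<open>
  \<open>\<gamma>\<close> gives a polynomial in the time parameter for each coordinate; \<open>curve_at \<gamma> t\<close> is the
  point at time \<open>t\<close>.
\<close>

definition curve_at :: "('s list \<Rightarrow> 'k poly) \<Rightarrow> 'k \<Rightarrow> 's list \<Rightarrow> 'k::comm_ring_1" where
  "curve_at \<gamma> t = (\<lambda>w. poly (\<gamma> w) t)"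

definition exp_curve ::
    "(('s list \<Rightarrow> 'k) \<Rightarrow> ('s list \<Rightarrow> 'k) \<Rightarrow> 's list \<Rightarrow> 'k) \<Rightarrow> ('s list \<Rightarrow> 'k::field_char_0) \<Rightarrow>
     ('s list \<Rightarrow> 'k poly) \<Rightarrow> bool" where
  "exp_curve law \<xi> \<gamma> \<longleftrightarrow>
     (\<forall>t. curve_at \<gamma> t \<in> ncseries) \<and>
     curve_at \<gamma> 0 = zero_series \<and>
     (\<forall>t. curve_at (\<lambda>w. pderiv (\<gamma> w)) t =
          mat_apply (jacobian (law (curve_at \<gamma> t)) zero_series) \<xi>)"

definition EXP ::
    "(('s list \<Rightarrow> 'k) \<Rightarrow> ('s list \<Rightarrow> 'k) \<Rightarrow> 's list \<Rightarrow> 'k) \<Rightarrow>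
     ('s list \<Rightarrow> 'k::field_char_0) \<Rightarrow> 's list \<Rightarrow> 'k" where
  "EXP law \<xi> = curve_at (THE \<gamma>. exp_curve law \<xi> \<gamma>) 1"

definition LOG ::
    "(('s list \<Rightarrow> 'k) \<Rightarrow> ('s list \<Rightarrow> 'k) \<Rightarrow> 's list \<Rightarrow> 'k) \<Rightarrow>
     ('s list \<Rightarrow> 'k::field_char_0) \<Rightarrow> 's list \<Rightarrow> 'k" where
  "LOG law = inv_into ncseries (EXP law)"

definition dR :: "'s list \<Rightarrow> 's list \<Rightarrow> 'k::field_char_0" where
  "dR = jacobian R_transform zero_series"

text \<open>Rows and columns are ordered by length and then lexicographically.\<close>

definition lower_unitriangular :: "('s::linorder list \<Rightarrow> 's list \<Rightarrow> 'k::comm_ring_1) \<Rightarrow> bool" where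
  "lower_unitriangular M \<longleftrightarrow>
     (\<forall>w. w \<noteq> [] \<longrightarrow> M w w = 1) \<and>
     (\<forall>w v. w \<noteq> [] \<longrightarrow> v \<noteq> [] \<longrightarrow> (w, v) \<in> lenlex {(a, b). a < b} \<longrightarrow> M w v = 0)"


section \<open>The recursion for the free product on polynomials\<close>

lemma functional_superset:
  assumes "finite A" "Poly_Mapping.keys p \<subseteq> A"
  shows "functional \<phi> p = (\<Sum>u\<in>A. Poly_Mapping.lookup p u * \<phi> u)"
  unfolding functional_def using assms
  by (intro sum.mono_neutral_left) (auto simp: in_keys_iff)

lemma functional_single [simp]: "functional \<phi> (Poly_Mapping.single u c) = c * \<phi> u"
  by (subst functional_superset[of "{u}"]) auto

lemma functional_zero [simp]: "functional \<phi> 0 = 0"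
  by (simp add: functional_def)

lemma functional_add: "functional \<phi> (p + q) = functional \<phi> p + functional \<phi> q"
proof -
  let ?A = "Poly_Mapping.keys p \<union> Poly_Mapping.keys q"
  have "Poly_Mapping.keys (p + q) \<subseteq> ?A"
    by (rule Poly_Mapping.keys_add)
  then show ?thesis
    by (subst (1 2 3) functional_superset[of ?A])
      (auto simp: lookup_add sum.distrib distrib_right)
qed

lemma functional_sum: "functional \<phi> (\<Sum>i\<in>A. p i) = (\<Sum>i\<in>A. functional \<phi> (p i))"
  by (induction A rule: infinite_finite_induct) (simp_all add: functional_add)

lemma ncpoly_eq_sum_single:
  "p = (\<Sum>u\<in>Poly_Mapping.keys p. Poly_Mapping.single u (Poly_Mapping.lookup p u))"
  by (rule poly_mapping_eqI)
    (auto simp: lookup_sum lookup_single when_def in_keys_iff)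

lemma functional_single_mult:
  "functional \<phi> (Poly_Mapping.single v c * q) = c * functional (\<lambda>w. \<phi> (v @ w)) q"
proof -
  have "functional \<phi> (Poly_Mapping.single v c * q) = (\<Sum>w\<in>Poly_Mapping.keys q.
      functional \<phi> (Poly_Mapping.single (v @ w) (c * Poly_Mapping.lookup q w)))"
    by (subst ncpoly_eq_sum_single[of q])
      (simp add: sum_distrib_left mult_single functional_sum plus_list_def del: functional_single)
  then show ?thesis
    by (simp add: functional_def[of _ q] sum_distrib_left mult.assoc)
qed

lemma functional_mult:
  "functional \<phi> (p * q) =
     (\<Sum>v\<in>Poly_Mapping.keys p. Poly_Mapping.lookup p v * functional (\<lambda>w. \<phi> (v @ w)) q)"
  by (subst ncpoly_eq_sum_single[of p])
    (simp add: sum_distrib_right functional_sum functional_single_mult)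

lemma functional_mult_linear:
  "functional \<phi> (q * (p * r)) =
     (\<Sum>u\<in>Poly_Mapping.keys p. Poly_Mapping.lookup p u *
        functional \<phi> (q * (Poly_Mapping.single u 1 * r)))"
  unfolding functional_mult functional_single_mult
  by (subst sum_distrib_left, subst sum.swap)
    (auto simp: sum_distrib_left mult.left_commute)

lemma prod_list_single:
  "prod_list (map (\<lambda>u. Poly_Mapping.single u (1::'k::comm_ring_1)) us) =
     Poly_Mapping.single (concat us) 1"
proof (induction us)
  case Nil
  have "Poly_Mapping.single [] (1::'k) = 1"
    by (metis single_one zero_list_def)
  then show ?case by simp
qed (simp add: mult_single plus_list_def)

lemma runs_append:
  assumes "b \<noteq> []" "\<forall>z\<in>set b. isl z = e" "u \<noteq> [] \<longrightarrow> isl (hd u) \<noteq> e"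
  shows "runs (b @ u) = b # runs u"
proof (cases b)
  case (Cons z b')
  have b': "\<forall>y\<in>set b'. isl y = isl z" and z: "isl z = e"
    using assms(2) Cons by auto
  have "takeWhile (\<lambda>y. isl y = isl z) u = []" "dropWhile (\<lambda>y. isl y = isl z) u = u"
    using assms(3) z by (cases u; simp)+
  with b' Cons show ?thesis
    by (simp add: takeWhile_append2 dropWhile_append2)
qed (use assms in simp)

lemma runs_concat:
  assumes "\<forall>i<length us. us ! i \<noteq> [] \<and> (\<forall>z\<in>set (us ! i). isl z = e i)"
    and "\<forall>i. Suc i < length us \<longrightarrow> e i \<noteq> e (Suc i)"
  shows "runs (concat us) = us"
  using assms
proof (induction us arbitrary: e)
  case (Cons b us)
  have IH: "runs (concat us) = us"
    using Cons.prems by (intro Cons.IH[of "\<lambda>i. e (Suc i)"]) auto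
  have b: "b \<noteq> []" "\<forall>z\<in>set b. isl z = e 0"
    using Cons.prems(1) by force+
  have "isl (hd (concat us)) \<noteq> e 0" if ne: "concat us \<noteq> []"
  proof (cases us)
    case (Cons c cs)
    then have c: "c \<noteq> []" "\<forall>z\<in>set c. isl z = e 1"
      using Cons.prems(1)[rule_format, of 1] by auto
    have "e 0 \<noteq> e 1"
      using Cons.prems(2)[rule_format, of 0] Cons by simp
    moreover have "isl (hd c) = e 1"
      using c by simp
    ultimately show ?thesis
      using c Cons by simp
  qed (use ne in simp)
  then show ?case
    using runs_append[of b "e 0" "concat us"] b IH by (simp del: concat_eq_Nil_conv)
qed simp

lemma freeprod_marginal:
  assumes "u \<noteq> []" "\<forall>z\<in>set u. isl z = e"
  shows "freeprod f g u = marginal f g u"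
proof -
  have r: "runs u = [u]"
    using runs_append[of u e "[]"] assms by simp
  have "{I. I \<subset> {..<Suc 0}} = {{}}"
    by (auto simp: psubset_eq subset_singleton_iff lessThan_Suc)
  then show ?thesis
    using assms by (subst freeprod.simps) (simp add: r freeprod.simps[of f g "[]"])
qed

lemma freeprod_alternating:
  fixes a :: "('s + 's, 'k::comm_ring_1) ncpoly list"
  assumes "a \<noteq> []"
    and "\<forall>i<length a. \<forall>u\<in>Poly_Mapping.keys (a ! i). u \<noteq> [] \<and> (\<forall>z\<in>set u. isl z = e i)"
    and "\<forall>i. Suc i < length a \<longrightarrow> e i \<noteq> e (Suc i)"
  shows "functional (freeprod f g) (prod_list a) =
    (\<Sum>I\<in>{I. I \<subset> {..<length a}}.
       (-1) ^ (length a - card I + 1) * functional (freeprod f g) (prod_list (nths a I)) *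
       (\<Prod>i\<in>{..<length a} - I. functional (marginal f g) (a ! i)))"
    (is "?L a = (\<Sum>I\<in>_. ?T a I)")
proof -
  let ?S = "\<lambda>u. Poly_Mapping.single u (1::'k)"
  let ?R = "\<lambda>a. \<Sum>I\<in>{I. I \<subset> {..<length a}}. ?T a I"
  have base: "?L (map ?S us) = ?R (map ?S us)"
    if us: "us \<noteq> []" "\<forall>i<length us. us ! i \<noteq> [] \<and> (\<forall>z\<in>set (us ! i). isl z = e i)"
      "\<forall>i. Suc i < length us \<longrightarrow> e i \<noteq> e (Suc i)" for us
  proof -
    have r: "runs (concat us) = us"
      using us(2,3) by (rule runs_concat)
    then have ne: "concat us \<noteq> []"
      using us(1) by (metis runs.simps(1))
    have prod: "(\<Prod>i\<in>{..<length us} - I. marginal f g (us ! i)) =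
        (\<Prod>i\<in>{..<length us} - I. functional (marginal f g) (map ?S us ! i))" for I
      by (intro prod.cong) simp_all
    show ?thesis
      unfolding nths_map prod_list_single functional_single
      by (subst freeprod.simps) (simp only: r ne if_False length_map mult_1_left prod)
  qed
  have split: "?L (q @ p # c) = (\<Sum>u\<in>Poly_Mapping.keys p. Poly_Mapping.lookup p u * ?L (q @ ?S u # c))"
    for q p c
    unfolding prod_list.append prod_list.Cons by (rule functional_mult_linear)
  have splitT: "?T (q @ p # c) I =
      (\<Sum>u\<in>Poly_Mapping.keys p. Poly_Mapping.lookup p u * ?T (q @ ?S u # c) I)" for q p c I
  proof (cases "length q \<in> I")
    case True
    have nths: "nths (q @ p' # c) I = nths q I @ p' # nths c {j. Suc (j + length q) \<in> I}" for p'
      using True by (simp add: nths_append nths_Cons)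
    have prod: "(\<Prod>i\<in>{..<length (q @ p # c)} - I. functional (marginal f g) ((q @ p' # c) ! i)) =
        (\<Prod>i\<in>{..<length (q @ p # c)} - I. functional (marginal f g) ((q @ p # c) ! i))" for p'
      using True by (intro prod.cong) (auto simp: nth_append nth_Cons')
    have len: "length (q @ ?S u # c) = length (q @ p # c)" for u
      by simp
    show ?thesis
      unfolding nths split[of "nths q I" p] len prod[of "?S _"]
      by (simp add: sum_distrib_left sum_distrib_right mult_ac)
  next
    case False
    have nths: "nths (q @ p' # c) I = nths (q @ p # c) I" for p'
      using False by (simp add: nths_append nths_Cons)
    let ?J = "{..<length (q @ p # c)} - I - {length q}"
    have prod: "(\<Prod>i\<in>{..<length (q @ p # c)} - I. functional (marginal f g) ((q @ p' # c) ! i)) =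
        functional (marginal f g) p' * (\<Prod>i\<in>?J. functional (marginal f g) ((q @ p # c) ! i))"
      (is "?P p' = _") for p'
    proof -
      have "?P p' = functional (marginal f g) ((q @ p' # c) ! length q) *
          (\<Prod>i\<in>?J. functional (marginal f g) ((q @ p' # c) ! i))"
        using False by (intro prod.remove) auto
      also have "(\<Prod>i\<in>?J. functional (marginal f g) ((q @ p' # c) ! i)) =
          (\<Prod>i\<in>?J. functional (marginal f g) ((q @ p # c) ! i))"
        by (intro prod.cong) (auto simp: nth_append nth_Cons')
      finally show ?thesis by simp
    qed
    have len: "length (q @ ?S u # c) = length (q @ p # c)" for u
      by simp
    show ?thesis
      unfolding len prod nths[of "?S _"]
      by (subst (1) functional_def) (simp add: sum_distrib_left sum_distrib_right mult_ac)
  qed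
  have splitR: "?R (q @ p # c) = (\<Sum>u\<in>Poly_Mapping.keys p. Poly_Mapping.lookup p u * ?R (q @ ?S u # c))"
    for q p c
    unfolding splitT[of q p c] by (subst sum.swap) (simp add: sum_distrib_left)
  have "?L (q @ map ?S us) = ?R (q @ map ?S us)"
    if "q @ map ?S us \<noteq> []"
      "\<forall>i<length (q @ map ?S us). \<forall>u\<in>Poly_Mapping.keys ((q @ map ?S us) ! i).
         u \<noteq> [] \<and> (\<forall>z\<in>set u. isl z = e i)"
      "\<forall>i. Suc i < length (q @ map ?S us) \<longrightarrow> e i \<noteq> e (Suc i)" for q us
    using that
  proof (induction q arbitrary: us rule: rev_induct)
    case Nil
    have "us \<noteq> []"
      using Nil.prems(1) by simp
    moreover have "\<forall>i<length us. us ! i \<noteq> [] \<and> (\<forall>z\<in>set (us ! i). isl z = e i)"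
      using Nil.prems(2) by simp
    moreover have "\<forall>i. Suc i < length us \<longrightarrow> e i \<noteq> e (Suc i)"
      using Nil.prems(3) unfolding append_Nil length_map .
    ultimately show ?case
      unfolding append_Nil by (rule base)
  next
    case (snoc p q)
    have eq: "?L (q @ ?S u # map ?S us) = ?R (q @ ?S u # map ?S us)"
      if u: "u \<in> Poly_Mapping.keys p" for u
    proof -
      have "?L (q @ map ?S (u # us)) = ?R (q @ map ?S (u # us))"
      proof (rule snoc.IH)
        show "\<forall>i<length (q @ map ?S (u # us)). \<forall>v\<in>Poly_Mapping.keys ((q @ map ?S (u # us)) ! i).
            v \<noteq> [] \<and> (\<forall>z\<in>set v. isl z = e i)"
        proof (intro allI impI ballI)
          fix i v
          assume i: "i < length (q @ map ?S (u # us))"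
            and v: "v \<in> Poly_Mapping.keys ((q @ map ?S (u # us)) ! i)"
          have "v \<in> Poly_Mapping.keys (((q @ [p]) @ map ?S us) ! i)"
            using v u i by (auto simp: nth_append nth_Cons' split: if_splits)
          with i show "v \<noteq> [] \<and> (\<forall>z\<in>set v. isl z = e i)"
            using snoc.prems(2)[rule_format, of i v] by auto
        qed
        have "length (q @ map ?S (u # us)) = length ((q @ [p]) @ map ?S us)"
          by simp
        then show "\<forall>i. Suc i < length (q @ map ?S (u # us)) \<longrightarrow> e i \<noteq> e (Suc i)"
          using snoc.prems(3) by metis
      qed simp
      then show ?thesis by simp
    qed
    have "?L (q @ p # map ?S us) = ?R (q @ p # map ?S us)"
      unfolding split[of q p] splitR[of q p] using eq by (intro sum.cong) auto
    then show ?case by simp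
  qed
  from this[of a "[]"] show ?thesis
    using assms unfolding list.map(1) append_Nil2 by blast
qed

end

(*
  Read a series xi as free cumulants and let mom xi w be the sum over the non-crossing partitions
  of the products of xi over the blocks. As Moeb inverts Zeta, the R-transform inverts mom. On the
  other hand, the part of the free product functional of f and g that is linear in g is explicit:
  on a monomial with k letters y it is the value of g at the word of these letters, times the
  values of f at the words of x's in the k cyclic gaps between them. All other blocks of a
  non-crossing partition lie in the cyclic gaps of a given block, hence differentiating
  mom (t xi) in t, which distinguishes a block, shows that t |-> mom (t xi) is the curve that
  defines EXP xi. So EXP = mom and LOG is the R-transform itself. Accordingly dR is the identity
  matrix: only the partition with one block is linear in f, and its coefficient is a product of
  first-order coefficients of Moeb, which are 1.
*)

theory Submission
  imports Defs
begin

section \<open>Sums over non-crossing partitions\<close>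

text \<open>The defining equation of \<open>EXP\<close> sees \<open>\<boxplus>\<close> only through
  its Jacobian in the second argument at 0, so the part linear in \<open>g\<close> suffices. It is
  extracted as a coefficient of degree one, after \<open>g\<close> has been multiplied by a formal
  parameter. The obstacle is that cyclic gaps come in two languages: the free product reads them off
  a monomial, the moment formula off a non-crossing partition. Counting the elements of a block up
  to a position, modulo the size of the block, gives one index for both; agreement of this index for
  all blocks also describes the Kreweras complement. That \<open>R_transform\<close> inverts
  \<open>mom\<close> is a case of associativity of \<open>\<boxtimes>\<close>. It is derived
  directly from one property of the Kreweras complement: it is an order-reversing bijection of the
  non-crossing partitions. An empty gap has to contribute the factor 1, the value of the functional
  at the empty product, while series vanish at the empty word; hence the updates
  \<open>f([] := 1)\<close>.\<close>

definition uncrossed :: "nat set \<Rightarrow> nat set \<Rightarrow> bool" where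
  "uncrossed V W \<longleftrightarrow> \<not> (\<exists>a\<in>V. \<exists>b\<in>W. \<exists>c\<in>V. \<exists>d\<in>W. a < b \<and> b < c \<and> c < d)"

text \<open>Arbitrary ground sets are allowed because blocks and cyclic gaps, in general not
  intervals, get partitioned in their turn.\<close>

definition nc_on :: "nat set \<Rightarrow> nat set set set" where
  "nc_on A = {P. partition_on A P \<and> noncrossing P}"

definition nc_sum :: "(nat set \<Rightarrow> 'k::comm_ring_1) \<Rightarrow> nat set \<Rightarrow> 'k" where
  "nc_sum h A = (\<Sum>P\<in>nc_on A. \<Prod>V\<in>P. h V)"

text \<open>\<open>uncrossed\<close> forbids only the pattern that starts in its first argument and
  is not symmetric; both orders enter because \<open>noncrossing\<close> ranges over ordered pairs
  of blocks.\<close>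

lemma noncrossing_iff_uncrossed:
  "noncrossing P \<longleftrightarrow> (\<forall>V\<in>P. \<forall>W\<in>P. V \<noteq> W \<longrightarrow> uncrossed V W)"
  by (simp add: noncrossing_def uncrossed_def)

lemma uncrossed_mono: "uncrossed V W \<Longrightarrow> V' \<subseteq> V \<Longrightarrow> W' \<subseteq> W \<Longrightarrow> uncrossed V' W'"
  unfolding uncrossed_def by (meson subsetD)

lemma NC_eq_nc_on: "NC n = nc_on {..<n}"
  by (simp add: NC_def nc_on_def)

lemma finite_nc_on: "finite A \<Longrightarrow> finite (nc_on A)"
  unfolding nc_on_def by (rule finite_subset[OF _ finitely_many_partition_on[of A]]) auto

lemma nc_onD:
  assumes "P \<in> nc_on A"
  shows "\<Union>P = A" "{} \<notin> P" "V \<in> P \<Longrightarrow> V \<subseteq> A"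
    "V \<in> P \<Longrightarrow> W \<in> P \<Longrightarrow> V \<noteq> W \<Longrightarrow> V \<inter> W = {}"
    "V \<in> P \<Longrightarrow> W \<in> P \<Longrightarrow> V \<noteq> W \<Longrightarrow> uncrossed V W"
  using assms
  by (auto simp: nc_on_def partition_on_def disjoint_def noncrossing_iff_uncrossed)

lemma nc_onI:
  assumes "\<Union>P = A" "{} \<notin> P"
    "\<And>V W. V \<in> P \<Longrightarrow> W \<in> P \<Longrightarrow> V \<noteq> W \<Longrightarrow> V \<inter> W = {}"
    "\<And>V W. V \<in> P \<Longrightarrow> W \<in> P \<Longrightarrow> V \<noteq> W \<Longrightarrow> uncrossed V W"
  shows "P \<in> nc_on A"
  using assms
  by (auto simp: nc_on_def partition_on_def disjoint_def noncrossing_iff_uncrossed)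

lemma finite_nc_on_elem: "finite A \<Longrightarrow> P \<in> nc_on A \<Longrightarrow> finite P"
  using nc_onD(1) finite_UnionD by blast

lemma nc_on_empty: "nc_on {} = {{}}"
  by (auto simp: nc_on_def partition_on_empty noncrossing_def)

lemma nc_sum_empty [simp]: "nc_sum h {} = 1"
  by (simp add: nc_sum_def nc_on_empty)

lemma nc_sum_cong:
  assumes "\<And>V. V \<subseteq> A \<Longrightarrow> V \<noteq> {} \<Longrightarrow> h V = h' V"
  shows "nc_sum h A = nc_sum h' A"
  unfolding nc_sum_def
proof (intro sum.cong prod.cong refl)
  fix P V assume "P \<in> nc_on A" "V \<in> P"
  then show "h V = h' V"
    using assms nc_onD(2,3) by metis
qed

lemma uncrossed_image:
  assumes "strict_mono_on A r" "V \<subseteq> A" "W \<subseteq> A"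
  shows "uncrossed (r ` V) (r ` W) \<longleftrightarrow> uncrossed V W"
proof -
  have "r a < r b \<longleftrightarrow> a < b" if "a \<in> A" "b \<in> A" for a b
    using assms(1) that strict_mono_on_less by blast
  with assms(2,3) show ?thesis
    unfolding uncrossed_def by (simp add: subset_iff)
qed

text \<open>A strictly monotone relabelling keeps every order pattern, hence every crossing; images
  and preimages of blocks give mutually inverse maps of partitions.\<close>

lemma nc_sum_image:
  assumes r: "strict_mono_on A r"
  shows "nc_sum h (r ` A) = nc_sum (\<lambda>V. h (r ` V)) A"
proof -
  have inj: "inj_on r A"
    using r by (rule strict_mono_on_imp_inj_on)
  let ?i = "\<lambda>Q. (\<lambda>W. A \<inter> r -` W) ` Q"
  let ?j = "\<lambda>P. (`) r ` P"
  have vim_im: "A \<inter> r -` (r ` V) = V" if "V \<subseteq> A" for V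
    using that inj by (auto dest: inj_onD)
  have im_vim: "r ` (A \<inter> r -` W) = W" if "W \<subseteq> r ` A" for W
    using that by blast
  have eqj: "V = W" if "r ` V = r ` W" "V \<subseteq> A" "W \<subseteq> A" for V W
    using that vim_im by metis
  have j: "?j P \<in> nc_on (r ` A)" if P: "P \<in> nc_on A" for P
  proof (rule nc_onI)
    show "\<Union>(?j P) = r ` A" using nc_onD(1)[OF P] by blast
    show "{} \<notin> ?j P" using nc_onD(2)[OF P] by auto
    fix V W assume VW: "V \<in> ?j P" "W \<in> ?j P" "V \<noteq> W"
    then obtain V' W' where *: "V = r ` V'" "W = r ` W'" "V' \<in> P" "W' \<in> P" "V' \<noteq> W'"
      by blast
    have sub: "V' \<subseteq> A" "W' \<subseteq> A" using nc_onD(3)[OF P] * by auto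
    have "V' \<inter> W' = {}" "uncrossed V' W'" using nc_onD(4,5)[OF P] * by auto
    then show "V \<inter> W = {}" "uncrossed V W"
      using * sub inj_on_image_Int[OF inj sub] uncrossed_image[OF r sub] by auto
  qed
  have i: "?i Q \<in> nc_on A" if Q: "Q \<in> nc_on (r ` A)" for Q
  proof (rule nc_onI)
    show "\<Union>(?i Q) = A" using nc_onD(1)[OF Q] by blast
    show "{} \<notin> ?i Q"
    proof
      assume "{} \<in> ?i Q"
      then obtain W where "W \<in> Q" "A \<inter> r -` W = {}" by force
      then show False
        using im_vim[of W] nc_onD(2,3)[OF Q] by (metis image_empty)
    qed
    fix V W assume VW: "V \<in> ?i Q" "W \<in> ?i Q" "V \<noteq> W"
    then obtain V' W' where *: "V = A \<inter> r -` V'" "W = A \<inter> r -` W'" "V' \<in> Q" "W' \<in> Q" "V' \<noteq> W'"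
      by blast
    have im: "r ` V = V'" "r ` W = W'"
      using im_vim * nc_onD(3)[OF Q] by auto
    have "V' \<inter> W' = {}" "uncrossed V' W'" using nc_onD(4,5)[OF Q] * by auto
    moreover have "V \<subseteq> A" "W \<subseteq> A" using * by auto
    ultimately show "V \<inter> W = {}" "uncrossed V W"
      using * im uncrossed_image[OF r, of V W] by auto
  qed
  show ?thesis
    unfolding nc_sum_def
  proof (rule sum.reindex_bij_witness[where i = ?j and j = ?i])
    fix Q assume Q: "Q \<in> nc_on (r ` A)"
    show "?i Q \<in> nc_on A" by (rule i[OF Q])
    show eq: "?j (?i Q) = Q"
      using im_vim nc_onD(3)[OF Q] by (force simp: image_image)
    have inj': "inj_on ((`) r) (?i Q)"
      by (rule inj_onI, rule eqj) auto
    have "(\<Prod>V\<in>?j (?i Q). h V) = (\<Prod>V\<in>?i Q. h (r ` V))"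
      using inj' by (subst prod.reindex) auto
    then show "(\<Prod>V\<in>?i Q. h (r ` V)) = (\<Prod>V\<in>Q. h V)"
      unfolding eq by simp
  next
    fix P assume P: "P \<in> nc_on A"
    show "?j P \<in> nc_on (r ` A)" by (rule j[OF P])
    show "?i (?j P) = P"
      using vim_im nc_onD(3)[OF P] by (force simp: image_image)
  qed
qed

text \<open>
  Only \<open>V\<close> and \<open>W\<close> of non-zero weight need to be uncrossed: in a family of pairwise uncrossed sets,
  a set and the union of the others may cross.
\<close>

lemma nc_sum_Un:
  assumes fin: "finite A" "finite B" and disj: "A \<inter> B = {}"
    and unc: "\<And>V W. V \<subseteq> A \<Longrightarrow> h V \<noteq> 0 \<Longrightarrow> W \<subseteq> B \<Longrightarrow> h' W \<noteq> 0 \<Longrightarrow> uncrossed V W \<and> uncrossed W V"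
  shows "nc_sum h A * nc_sum h' B =
    nc_sum (\<lambda>V. if V \<subseteq> A then h V else if V \<subseteq> B then h' V else 0) (A \<union> B)"
proof -
  let ?H = "\<lambda>V. if V \<subseteq> A then h V else if V \<subseteq> B then h' V else 0"
  let ?SA = "{P \<in> nc_on A. \<forall>V\<in>P. h V \<noteq> 0}"
  let ?SB = "{P \<in> nc_on B. \<forall>V\<in>P. h' V \<noteq> 0}"
  let ?S = "{P \<in> nc_on (A \<union> B). \<forall>V\<in>P. ?H V \<noteq> 0}"
  \<comment> \<open>A block of weight 0 annihilates its partition, so all sums may be restricted to
    partitions in which the assumption on crossings applies to every block.\<close>
  have restrict: "nc_sum k C = (\<Sum>P\<in>{P \<in> nc_on C. \<forall>V\<in>P. k V \<noteq> 0}. \<Prod>V\<in>P. k V)"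
    if "finite C" for k :: "nat set \<Rightarrow> 'a" and C
    unfolding nc_sum_def
    using finite_nc_on[OF that] finite_nc_on_elem[OF that]
    by (intro sum.mono_neutral_right) (auto intro: prod_zero)
  have empty: "\<not> V \<subseteq> A" if "V \<subseteq> B" "V \<noteq> {}" for V
    using that disj by blast
  have H: "(\<Prod>V\<in>P \<union> Q. ?H V) = (\<Prod>V\<in>P. h V) * (\<Prod>V\<in>Q. h' V)"
    if P: "P \<in> nc_on A" and Q: "Q \<in> nc_on B" for P Q
  proof -
    have "P \<inter> Q = {}"
    proof (rule equals0I)
      fix V assume "V \<in> P \<inter> Q"
      then have "V \<subseteq> A" "V \<subseteq> B" "V \<noteq> {}"
        using nc_onD(2,3)[OF P] nc_onD(3)[OF Q] by auto
      with empty show False by metis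
    qed
    then have "(\<Prod>V\<in>P \<union> Q. ?H V) = (\<Prod>V\<in>P. ?H V) * (\<Prod>V\<in>Q. ?H V)"
      using fin P Q finite_nc_on_elem by (intro prod.union_disjoint) auto
    also have "(\<Prod>V\<in>P. ?H V) = (\<Prod>V\<in>P. h V)"
      using nc_onD(3)[OF P] by (intro prod.cong) auto
    also have "(\<Prod>V\<in>Q. ?H V) = (\<Prod>V\<in>Q. h' V)"
    proof (intro prod.cong refl)
      fix V assume "V \<in> Q"
      then have "V \<subseteq> B" "V \<noteq> {}" using nc_onD(2,3)[OF Q] by auto
      then show "?H V = h' V" using empty by auto
    qed
    finally show ?thesis .
  qed
  have "nc_sum h A * nc_sum h' B = (\<Sum>(P, Q)\<in>?SA \<times> ?SB. (\<Prod>V\<in>P. h V) * (\<Prod>V\<in>Q. h' V))"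
    by (simp add: restrict fin sum_product sum.cartesian_product)
  also have "\<dots> = (\<Sum>P\<in>?S. \<Prod>V\<in>P. ?H V)"
  proof (rule sum.reindex_bij_witness
      [where i = "\<lambda>R. ({V \<in> R. V \<subseteq> A}, {V \<in> R. V \<subseteq> B})" and j = "\<lambda>(P, Q). P \<union> Q"], goal_cases)
    case (1 x)
    obtain P Q where x: "x = (P, Q)" "P \<in> nc_on A" "Q \<in> nc_on B"
      using 1 by auto
    have "\<not> V \<subseteq> B" if "V \<in> P" for V
      using that nc_onD(2,3)[OF x(2)] empty by blast
    moreover have "\<not> V \<subseteq> A" if "V \<in> Q" for V
      using that nc_onD(2,3)[OF x(3)] empty by blast
    ultimately have "{V \<in> P \<union> Q. V \<subseteq> A} = P" "{V \<in> P \<union> Q. V \<subseteq> B} = Q"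
      using nc_onD(3)[OF x(2)] nc_onD(3)[OF x(3)] by blast+
    then show ?case
      using x(1) by simp
  next
    case (2 x)
    obtain P Q where x: "x = (P, Q)" and P: "P \<in> nc_on A" "\<forall>V\<in>P. h V \<noteq> 0"
      and Q: "Q \<in> nc_on B" "\<forall>V\<in>Q. h' V \<noteq> 0"
      using 2 by auto
    have QA: "\<not> V \<subseteq> A" if "V \<in> Q" for V
      using that nc_onD(2,3)[OF Q(1)] empty by blast
    have "P \<union> Q \<in> nc_on (A \<union> B)"
    proof (rule nc_onI)
      show "\<Union>(P \<union> Q) = A \<union> B" using nc_onD(1)[OF P(1)] nc_onD(1)[OF Q(1)] by auto
      show "{} \<notin> P \<union> Q" using nc_onD(2)[OF P(1)] nc_onD(2)[OF Q(1)] by auto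
      fix V W assume VW: "V \<in> P \<union> Q" "W \<in> P \<union> Q" "V \<noteq> W"
      have *: "V \<inter> W = {} \<and> uncrossed V W \<and> uncrossed W V" if "V \<in> P" "W \<in> Q" for V W
        using unc[of V W] nc_onD(3)[OF P(1)] nc_onD(3)[OF Q(1)] P(2) Q(2) that disj by blast
      show "V \<inter> W = {}"
        using VW * nc_onD(4)[OF P(1)] nc_onD(4)[OF Q(1)] by (metis Un_iff inf_commute)
      show "uncrossed V W"
        using VW * nc_onD(5)[OF P(1)] nc_onD(5)[OF Q(1)] by (metis Un_iff)
    qed
    moreover have "?H V \<noteq> 0" if "V \<in> P \<union> Q" for V
    proof (cases "V \<in> P")
      case True
      then show ?thesis using P(2) nc_onD(3)[OF P(1)] by simp
    next
      case False
      then show ?thesis using that QA Q(2) nc_onD(3)[OF Q(1)] by simp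
    qed
    ultimately show ?case
      using x by simp
  next
    case (3 R)
    then have "V \<subseteq> A \<or> V \<subseteq> B" if "V \<in> R" for V
      using that by (metis (mono_tags, lifting) mem_Collect_eq)
    then show ?case by auto
  next
    case (4 R)
    then have R: "R \<in> nc_on (A \<union> B)" and nz: "\<forall>V\<in>R. ?H V \<noteq> 0"
      by auto
    \<comment> \<open>The weight \<open>?H\<close> is 0 in all other cases; this excludes blocks
      that meet both sets.\<close>
    have AB: "V \<subseteq> A \<or> V \<subseteq> B" if "V \<in> R" for V
      using that nz by metis
    have sub: "{V \<in> R. V \<subseteq> C} \<in> nc_on C" if "C = A \<or> C = B" for C
    proof (rule nc_onI)
      show "\<Union>{V \<in> R. V \<subseteq> C} = C"
      proof
        show "C \<subseteq> \<Union>{V \<in> R. V \<subseteq> C}"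
        proof
          fix x assume x: "x \<in> C"
          then have "x \<in> \<Union>R"
            using nc_onD(1)[OF R] that by auto
          then obtain V where V: "V \<in> R" "x \<in> V"
            by blast
          then have "V \<subseteq> C"
            using AB[OF V(1)] x that disj by (metis disjoint_iff subset_iff)
          with V show "x \<in> \<Union>{V \<in> R. V \<subseteq> C}" by blast
        qed
      qed auto
    qed (use nc_onD[OF R] in auto)
    have "h V \<noteq> 0" if "V \<in> R" "V \<subseteq> A" for V
      using nz that by metis
    moreover have "h' V \<noteq> 0" if "V \<in> R" "V \<subseteq> B" for V
    proof -
      have "V \<noteq> {}" using nc_onD(2)[OF R] that by auto
      then have "\<not> V \<subseteq> A" using empty that by blast
      then show ?thesis using nz that by metis
    qed
    ultimately show ?case
      using sub by auto
  next
    case (5 x)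
    then show ?case using H by auto
  qed
  also have "\<dots> = nc_sum ?H (A \<union> B)"
    using fin by (simp add: restrict[of "A \<union> B" ?H])
  finally show ?thesis .
qed

text \<open>Induction by \<open>nc_sum_Un\<close>. The accumulated weight vanishes on blocks that
  spread over several \<open>A c\<close>; such blocks might cross the new set, while a block inside
  a single one does not.\<close>

lemma prod_nc_sum:
  assumes "finite C" "\<And>c. c \<in> C \<Longrightarrow> finite (A c)"
    and "\<And>c d. c \<in> C \<Longrightarrow> d \<in> C \<Longrightarrow> c \<noteq> d \<Longrightarrow> A c \<inter> A d = {} \<and> uncrossed (A c) (A d)"
  shows "(\<Prod>c\<in>C. nc_sum h (A c)) =
    nc_sum (\<lambda>V. if \<exists>c\<in>C. V \<subseteq> A c then h V else 0) (\<Union>c\<in>C. A c)"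
  using assms
proof (induction C rule: finite_induct)
  case (insert c C)
  let ?h = "\<lambda>V. if \<exists>c\<in>C. V \<subseteq> A c then h V else 0"
  have "(\<Prod>c\<in>insert c C. nc_sum h (A c)) = nc_sum h (A c) * nc_sum ?h (\<Union>c\<in>C. A c)"
    using insert by simp
  also have "\<dots> = nc_sum (\<lambda>V. if V \<subseteq> A c then h V else if V \<subseteq> (\<Union>c\<in>C. A c) then ?h V else 0)
      (A c \<union> (\<Union>c\<in>C. A c))"
  proof (rule nc_sum_Un)
    show "A c \<inter> (\<Union>c\<in>C. A c) = {}"
      using insert.prems(2)[of c] insert.hyps(2) by blast
    fix V W assume "V \<subseteq> A c" "?h W \<noteq> 0"
    then obtain d where d: "d \<in> C" "W \<subseteq> A d" by (metis (full_types))
    have "uncrossed (A c) (A d)" "uncrossed (A d) (A c)"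
      using insert.prems(2)[of c d] insert.prems(2)[of d c] insert.hyps(2) d by auto
    with \<open>V \<subseteq> A c\<close> d show "uncrossed V W \<and> uncrossed W V"
      by (meson uncrossed_mono)
  qed (use insert in auto)
  also have "\<dots> = nc_sum (\<lambda>V. if \<exists>c\<in>insert c C. V \<subseteq> A c then h V else 0) (\<Union>c\<in>insert c C. A c)"
  proof -
    have "V \<subseteq> (\<Union>c\<in>C. A c)" if "\<exists>c\<in>C. V \<subseteq> A c" for V
      using that by blast
    then have "(if V \<subseteq> A c then h V else if V \<subseteq> (\<Union>c\<in>C. A c) then ?h V else 0) =
        (if \<exists>c\<in>insert c C. V \<subseteq> A c then h V else 0)" for V
      by (cases "V \<subseteq> A c"; cases "\<exists>c\<in>C. V \<subseteq> A c") simp_all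
    then show ?thesis by simp
  qed
  finally show ?case .
qed simp

text \<open>Weight 0 off \<open>V\<close> kills every partition except the one with a single block.
  A prescribed block is thereby written as a sum over partitions and can serve as a factor in
  \<open>nc_sum_Un\<close>.\<close>

lemma nc_sum_singleton_block:
  assumes "V \<noteq> {}" "finite V"
  shows "nc_sum (\<lambda>W. if W = V then h W else 0) V = h V"
proof -
  have eq: "nc_on V \<inter> {P. V \<in> P} = {{V}}"
  proof -
    have one: "P = {V}" if "P \<in> nc_on V" "V \<in> P" for P
    proof -
      have "W = V" if "W \<in> P" for W
        using nc_onD(2-4)[OF \<open>P \<in> nc_on V\<close>] that \<open>V \<in> P\<close> by (metis inf.absorb1)
      with \<open>V \<in> P\<close> show ?thesis by blast
    qed
    have "{V} \<in> nc_on V"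
      using assms by (intro nc_onI) auto
    then show ?thesis
      by (intro equalityI subsetI; elim IntE singletonE CollectE)
        (erule one[THEN ssubst], assumption, rule singletonI, simp)
  qed
  have "nc_sum (\<lambda>W. if W = V then h W else 0) V =
        (\<Sum>P\<in>nc_on V \<inter> {P. V \<in> P}. \<Prod>W\<in>P. if W = V then h W else 0)"
      unfolding nc_sum_def
    proof (rule sum.mono_neutral_right)
      show "\<forall>P\<in>nc_on V - nc_on V \<inter> {P. V \<in> P}. (\<Prod>W\<in>P. if W = V then h W else 0) = 0"
      proof
        fix P assume P: "P \<in> nc_on V - nc_on V \<inter> {P. V \<in> P}"
        then obtain W where "W \<in> P"
          using nc_onD(1) assms by blast
        moreover have "finite P"
          using finite_nc_on_elem[OF assms(2)] P by auto
        moreover have "W \<noteq> V" using P \<open>W \<in> P\<close> by auto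
        ultimately show "(\<Prod>W\<in>P. if W = V then h W else 0) = 0"
          by (intro prod_zero) auto
      qed
    qed (use finite_nc_on[OF assms(2)] in auto)
  then show ?thesis unfolding eq by simp
qed

section \<open>The Kreweras complement\<close>

text \<open>
  The point just to the right of \<open>i\<close> lies in one of the \<open>card V\<close> cyclic gaps between the elements
  of \<open>V\<close>, where the parts before the first and after the last element together form gap \<open>0\<close>;
  \<open>key V i\<close> is the number of this gap. Two points belong to the same block of the Kreweras
  complement of \<open>P\<close> when no block of \<open>P\<close> separates them, i.e. when all keys agree.
\<close>

definition key :: "nat set \<Rightarrow> nat \<Rightarrow> nat" where
  "key V i = card {v \<in> V. v \<le> i} mod card V"

definition kr :: "nat \<Rightarrow> nat set set \<Rightarrow> nat set set" where
  "kr n P = {..<n} // {(i, j). i < n \<and> j < n \<and> (\<forall>V\<in>P. key V i = key V j)}"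

text \<open>For an interval \<open>S\<close> of positions on a circle: cutting the circle at both
  ends of \<open>S\<close> does not separate elements of \<open>V\<close>.\<close>

definition unsplit :: "nat set \<Rightarrow> nat set \<Rightarrow> bool" where
  "unsplit V S \<longleftrightarrow> V \<inter> S = {} \<or> V \<subseteq> S"

lemma not_unsplitE:
  assumes "\<not> unsplit V S"
  obtains x y where "x \<in> V" "x \<in> S" "y \<in> V" "y \<notin> S"
  using assms unfolding unsplit_def by blast

lemma unsplitD: "unsplit V S \<Longrightarrow> x \<in> V \<Longrightarrow> x \<in> S \<Longrightarrow> y \<in> V \<Longrightarrow> y \<in> S"
  unfolding unsplit_def by blast

text \<open>An element of \<open>V\<close> in \<open>{a<..b}\<close> forces \<open>V\<close> into
  \<open>{a<..c}\<close>; an element outside \<open>{a<..b}\<close> then lies in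
  \<open>{b<..c}\<close> and forces \<open>V\<close> into \<open>{b<..d}\<close>, a contradiction.
  This is why neither blocks of the complement nor gaps can cross.\<close>

lemma unsplit_crossing:
  assumes "unsplit V {a<..c}" "unsplit V {b<..d}" "a < b" "b < c" "c < (d::nat)"
  shows "unsplit V {a<..b}"
proof (rule ccontr)
  assume "\<not> unsplit V {a<..b}"
  then obtain x y where xy: "x \<in> V" "x \<in> {a<..b}" "y \<in> V" "y \<notin> {a<..b}"
    by (rule not_unsplitE)
  have "y \<in> {a<..c}" using unsplitD[OF assms(1), of x y] xy assms by auto
  then have "y \<in> {b<..d}" using xy assms by auto
  then show False using unsplitD[OF assms(2), of y x] xy by auto
qed

text \<open>From \<open>i\<close> to \<open>j\<close> the count in \<open>key\<close> grows by the
  number of elements of \<open>V\<close> in \<open>{i<..j}\<close>. Being at most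
  \<open>card V\<close>, it is divisible by \<open>card V\<close> only if it is 0 or
  \<open>card V\<close>. The interval is half-open because the points compared lie just right of
  \<open>i\<close> and of \<open>j\<close>.\<close>

lemma key_eq_iff:
  assumes "finite V" "V \<noteq> {}" "i \<le> j"
  shows "key V i = key V j \<longleftrightarrow> unsplit V {i<..j}"
proof -
  define a where "a = card {v \<in> V. v \<le> i}"
  define b where "b = card (V \<inter> {i<..j})"
  have "{v \<in> V. v \<le> j} = {v \<in> V. v \<le> i} \<union> (V \<inter> {i<..j})"
    using assms(3) by auto
  then have ab: "card {v \<in> V. v \<le> j} = a + b"
    unfolding a_def b_def using assms(1) by (subst card_Un_disjoint[symmetric]) auto
  have pos: "0 < card V" using assms by (simp add: card_gt_0_iff)
  have le: "b \<le> card V" unfolding b_def using assms(1) by (intro card_mono) auto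
  have "key V i = key V j \<longleftrightarrow> a mod card V = (a + b) mod card V"
    unfolding key_def ab a_def ..
  also have "\<dots> \<longleftrightarrow> card V dvd b"
    using mod_eq_dvd_iff_nat[of a "a + b" "card V"] by (simp add: eq_commute)
  also have "\<dots> \<longleftrightarrow> b = 0 \<or> b = card V"
    using le pos by (auto dest: dvd_imp_le)
  also have "b = 0 \<longleftrightarrow> V \<inter> {i<..j} = {}"
    unfolding b_def using assms(1) by simp
  also have "b = card V \<longleftrightarrow> V \<subseteq> {i<..j}"
  proof
    assume "b = card V"
    then have "V \<inter> {i<..j} = V"
      unfolding b_def using assms(1) by (intro card_subset_eq) auto
    then show "V \<subseteq> {i<..j}" by blast
  qed (auto simp: b_def Int_absorb2)
  finally show ?thesis unfolding unsplit_def .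
qed

lemma kr_equiv: "equiv {..<n} {(i, j). i < n \<and> j < n \<and> (\<forall>V\<in>P. key V i = key V j)}"
  by (rule equivI) (auto simp: refl_on_def sym_def trans_def)

lemma kr_partition: "partition_on {..<n} (kr n P)"
  unfolding kr_def by (rule partition_on_quotient[OF kr_equiv])

lemma kr_block_iff:
  "(\<exists>U\<in>kr n P. i \<in> U \<and> j \<in> U) \<longleftrightarrow> i < n \<and> j < n \<and> (\<forall>V\<in>P. key V i = key V j)"
proof
  assume "\<exists>U\<in>kr n P. i \<in> U \<and> j \<in> U"
  then obtain U where U: "U \<in> kr n P" "i \<in> U" "j \<in> U" by blast
  then have "(i, j) \<in> {(i, j). i < n \<and> j < n \<and> (\<forall>V\<in>P. key V i = key V j)}"
    using quotient_eq_iff[OF kr_equiv U(1)[unfolded kr_def] U(1)[unfolded kr_def] U(2,3)] by simp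
  then show "i < n \<and> j < n \<and> (\<forall>V\<in>P. key V i = key V j)" by auto
next
  assume *: "i < n \<and> j < n \<and> (\<forall>V\<in>P. key V i = key V j)"
  let ?r = "{(i, j). i < n \<and> j < n \<and> (\<forall>V\<in>P. key V i = key V j)}"
  have "?r `` {i} \<in> kr n P" unfolding kr_def using * by (intro quotientI) auto
  moreover have "i \<in> ?r `` {i}" "j \<in> ?r `` {i}" using * by auto
  ultimately show "\<exists>U\<in>kr n P. i \<in> U \<and> j \<in> U"
    by (intro bexI[of _ "?r `` {i}"] conjI)
qed

lemma nc_on_block_finite:
  assumes "P \<in> nc_on {..<n}" "V \<in> P"
  shows "finite V" "V \<noteq> {}"
  using nc_onD(2,3)[OF assms(1)] assms(2) finite_subset by auto

lemma nc_on_same_block: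
  assumes "P \<in> nc_on A" "V \<in> P" "W \<in> P" "x \<in> V" "x \<in> W"
  shows "V = W"
  using nc_onD(4)[OF assms(1-3)] assms(4,5) by blast

lemma kr_block_iff_le:
  assumes "P \<in> nc_on {..<n}" "i \<le> j"
  shows "(\<exists>U\<in>kr n P. i \<in> U \<and> j \<in> U) \<longleftrightarrow> j < n \<and> (\<forall>V\<in>P. unsplit V {i<..j})"
  using assms(2) key_eq_iff[OF nc_on_block_finite[OF assms(1)] assms(2)]
  by (auto simp: kr_block_iff)

text \<open>If two blocks of the complement cross at a < b < c < d, then
  \<open>unsplit_crossing\<close> puts a and b into one block, so the two blocks coincide.\<close>

lemma kr_in_nc_on:
  assumes P: "P \<in> nc_on {..<n}"
  shows "kr n P \<in> nc_on {..<n}"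
proof -
  have part: "partition_on {..<n} (kr n P)" by (rule kr_partition)
  have eq: "U = W"
    if "U \<in> kr n P" "W \<in> kr n P" "a \<in> U" "b \<in> W" "c \<in> U" "d \<in> W" "a < b" "b < c" "c < d"
    for U W a b c d
  proof -
    have ac: "c < n" "unsplit V {a<..c}" if "V \<in> P" for V
      using kr_block_iff_le[OF P, of a c] that \<open>U \<in> _\<close> \<open>a \<in> U\<close> \<open>c \<in> U\<close> \<open>a < b\<close> \<open>b < c\<close> by auto
    have bd: "d < n" "unsplit V {b<..d}" if "V \<in> P" for V
      using kr_block_iff_le[OF P, of b d] that \<open>W \<in> _\<close> \<open>b \<in> W\<close> \<open>d \<in> W\<close> \<open>c < d\<close> \<open>b < c\<close> by auto
    have "unsplit V {a<..b}" if "V \<in> P" for V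
      by (rule unsplit_crossing[OF ac(2)[OF that] bd(2)[OF that] \<open>a < b\<close> \<open>b < c\<close> \<open>c < d\<close>])
    moreover have "b < n"
      using kr_block_iff[of n P b b] that(2,4) by blast
    ultimately obtain X where "X \<in> kr n P" "a \<in> X" "b \<in> X"
      using kr_block_iff_le[OF P, of a b] \<open>a < b\<close> by auto
    then show ?thesis
      using that part unfolding partition_on_def disjoint_def by (metis disjoint_iff)
  qed
  have "noncrossing (kr n P)"
    unfolding noncrossing_def using eq by metis
  with part show ?thesis by (simp add: nc_on_def)
qed

text \<open>Between the interlaced points of \<open>i\<close> and \<open>j\<close> on the odd side
  lie exactly the even points of \<open>{i<..j}\<close>; a block of \<open>P\<close> crosses this
  pair iff it has elements both inside and outside.\<close>

lemma noncrossing_interlace_iff: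
  assumes P: "P \<in> nc_on {..<n}" and Q: "Q \<in> nc_on {..<n}"
  shows "noncrossing (interlace P Q) \<longleftrightarrow>
    (\<forall>U\<in>Q. \<forall>i\<in>U. \<forall>j\<in>U. i < j \<longrightarrow> (\<forall>V\<in>P. unsplit V {i<..j}))"
proof
  assume nc: "noncrossing (interlace P Q)"
  show "\<forall>U\<in>Q. \<forall>i\<in>U. \<forall>j\<in>U. i < j \<longrightarrow> (\<forall>V\<in>P. unsplit V {i<..j})"
  proof (intro ballI impI, rule ccontr)
    fix U i j V assume *: "U \<in> Q" "i \<in> U" "j \<in> U" "i < j" "V \<in> P" "\<not> unsplit V {i<..j}"
    then obtain x y where xy: "x \<in> V" "i < x" "x \<le> j" "y \<in> V" "y \<le> i \<or> j < y"
      by (auto elim!: not_unsplitE)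
    let ?V = "(\<lambda>i. 2 * i) ` V" and ?U = "(\<lambda>i. 2 * i + 1) ` U"
    have mem: "?V \<in> interlace P Q" "?U \<in> interlace P Q"
      using * by (auto simp: interlace_def)
    have el: "2 * x \<in> ?V" "2 * y \<in> ?V" "2 * i + 1 \<in> ?U" "2 * j + 1 \<in> ?U"
      using xy * by auto
    have ne: "?V \<noteq> ?U"
    proof
      assume "?V = ?U"
      then have "2 * x \<in> ?U" using el by metis
      then show False by (auto, presburger)
    qed
    have unc: "uncrossed ?V ?U" "uncrossed ?U ?V"
      using nc mem ne by (metis noncrossing_iff_uncrossed)+
    from xy(5) show False
    proof
      assume "y \<le> i"
      then have "2 * y < 2 * i + 1" "2 * i + 1 < 2 * x" "2 * x < 2 * j + 1" using xy by auto
      with unc(1) el show False unfolding uncrossed_def by metis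
    next
      assume "j < y"
      then have "2 * i + 1 < 2 * x" "2 * x < 2 * j + 1" "2 * j + 1 < 2 * y" using xy by auto
      with unc(2) el show False unfolding uncrossed_def by metis
    qed
  qed
next
  assume R: "\<forall>U\<in>Q. \<forall>i\<in>U. \<forall>j\<in>U. i < j \<longrightarrow> (\<forall>V\<in>P. unsplit V {i<..j})"
  have uns: "x \<in> {i<..j} \<Longrightarrow> y \<in> {i<..j}"
    if "U \<in> Q" "i \<in> U" "j \<in> U" "i < j" "V \<in> P" "x \<in> V" "y \<in> V" for U V i j x y
    using R that unsplitD by metis
  have dist: "V \<noteq> W" if "f ` V \<noteq> f ` W" for f :: "nat \<Rightarrow> nat" and V W
    using that by blast
  have sm: "strict_mono_on UNIV (\<lambda>i::nat. 2 * i)" "strict_mono_on UNIV (\<lambda>i::nat. 2 * i + 1)"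
    by (auto simp: strict_mono_on_def)
  have PP: "uncrossed ((\<lambda>i. 2 * i) ` V) ((\<lambda>i. 2 * i) ` W)" if "V \<in> P" "W \<in> P" "V \<noteq> W" for V W
    using uncrossed_image[OF sm(1)] nc_onD(5)[OF P that] by auto
  have QQ: "uncrossed ((\<lambda>i. 2 * i + 1) ` V) ((\<lambda>i. 2 * i + 1) ` W)" if "V \<in> Q" "W \<in> Q" "V \<noteq> W" for V W
    using uncrossed_image[OF sm(2)] nc_onD(5)[OF Q that] by auto
  have PQ: "uncrossed ((\<lambda>i. 2 * i) ` V) ((\<lambda>i. 2 * i + 1) ` U)" if "V \<in> P" "U \<in> Q" for V U
    unfolding uncrossed_def
  proof (rule notI, clarify)
    fix v u v' u' assume *: "v \<in> V" "u \<in> U" "v' \<in> V" "u' \<in> U"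
      "2 * v < 2 * u + 1" "2 * u + 1 < 2 * v'" "2 * v' < 2 * u' + 1"
    have "v \<in> {u<..u'}" by (rule uns[of U u u' V v' v]) (use that * in auto)
    then show False using * by auto
  qed
  have QP: "uncrossed ((\<lambda>i. 2 * i + 1) ` U) ((\<lambda>i. 2 * i) ` V)" if "V \<in> P" "U \<in> Q" for V U
    unfolding uncrossed_def
  proof (rule notI, clarify)
    fix u v u' v' assume *: "u \<in> U" "v \<in> V" "u' \<in> U" "v' \<in> V"
      "2 * u + 1 < 2 * v" "2 * v < 2 * u' + 1" "2 * u' + 1 < 2 * v'"
    have "v' \<in> {u<..u'}" by (rule uns[of U u u' V v v']) (use that * in auto)
    then show False using * by auto
  qed
  show "noncrossing (interlace P Q)"
    unfolding noncrossing_iff_uncrossed interlace_def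
    by (intro ballI impI; elim UnE imageE; hypsubst; rule PP QQ PQ QP; use dist in blast)
qed

text \<open>A compatible \<open>Q\<close> joins only positions that no block of \<open>P\<close>
  separates, and \<open>kr n P\<close> joins all of these. Two coarsest candidates refine each other
  and are therefore equal.\<close>

lemma kreweras_eq_kr:
  assumes P: "P \<in> NC n"
  shows "kreweras n P = kr n P"
  unfolding kreweras_def
proof (rule the_equality)
  have P': "P \<in> nc_on {..<n}" using P by (simp add: NC_eq_nc_on)
  have K: "kr n P \<in> nc_on {..<n}" by (rule kr_in_nc_on[OF P'])
  have nc: "noncrossing (interlace P (kr n P))"
    unfolding noncrossing_interlace_iff[OF P' K] using kr_block_iff_le[OF P'] by (meson less_imp_le)
  have coarsest: "refines {..<n} Q (kr n P)" if "Q \<in> NC n" "noncrossing (interlace P Q)" for Q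
  proof -
    have Q: "Q \<in> nc_on {..<n}" using that by (simp add: NC_eq_nc_on)
    have uns: "unsplit V {i<..j}" if "U \<in> Q" "i \<in> U" "j \<in> U" "i < j" "V \<in> P" for U V i j
      using that \<open>noncrossing (interlace P Q)\<close> unfolding noncrossing_interlace_iff[OF P' Q] by metis
    have "\<exists>Y\<in>kr n P. U \<subseteq> Y" if U: "U \<in> Q" for U
    proof -
      have Un: "U \<subseteq> {..<n}" and "U \<noteq> {}" using nc_onD(2,3)[OF Q] U by auto
      then obtain i where i: "i \<in> U" by blast
      obtain Y where Y: "Y \<in> kr n P" "i \<in> Y"
        using kr_block_iff[of n P i i] i Un by auto
      have "j \<in> Y" if j: "j \<in> U" for j
      proof -
        have sym: "\<exists>X\<in>kr n P. i \<in> X \<and> j \<in> X"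
        proof (cases i j rule: linorder_cases)
          case less
          then show ?thesis
            using kr_block_iff_le[OF P', of i j] uns[OF U i j] j Un by auto
        next
          case equal
          then show ?thesis using Y by auto
        next
          case greater
          then show ?thesis
            using kr_block_iff_le[OF P', of j i] uns[OF U j i] i Un by auto
        qed
        then show ?thesis
          using nc_on_same_block[OF K Y(1)] Y(2) by metis
      qed
      with Y show ?thesis by blast
    qed
    then show ?thesis
      using Q K by (auto simp: refines_def nc_on_def)
  qed
  show *: "kr n P \<in> NC n \<and> noncrossing (interlace P (kr n P)) \<and>
    (\<forall>Q'\<in>NC n. noncrossing (interlace P Q') \<longrightarrow> refines {..<n} Q' (kr n P))"
    using K nc coarsest by (simp add: NC_eq_nc_on)
  fix Q assume Q: "Q \<in> NC n \<and> noncrossing (interlace P Q) \<and>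
    (\<forall>Q'\<in>NC n. noncrossing (interlace P Q') \<longrightarrow> refines {..<n} Q' Q)"
  then have "refines {..<n} Q (kr n P)" "refines {..<n} (kr n P) Q"
    using * by auto
  then show "Q = kr n P" by (rule refines_asym)
qed

text \<open>
  The partition is thus recovered from its complement, so \<open>kr n\<close> is injective. For the converse
  direction, the neighbours \<open>v1\<close> and \<open>v2\<close> of \<open>j\<close> in the cyclic order of the block of \<open>i\<close> bound a gap
  whose two extreme points are in the same block of the complement.
\<close>

lemma same_block_iff_kr:
  assumes P: "P \<in> nc_on {..<n}" and ij: "i < j" "j < n"
  shows "(\<exists>V\<in>P. i \<in> V \<and> j \<in> V) \<longleftrightarrow> (\<forall>U\<in>kr n P. unsplit U {i..<j})"
proof
  assume "\<exists>V\<in>P. i \<in> V \<and> j \<in> V"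
  then obtain V where V: "V \<in> P" "i \<in> V" "j \<in> V" by blast
  \<comment> \<open>Closed at \<open>i\<close> and open at \<open>j\<close>: the complement points
    between \<open>i\<close> and \<open>j\<close> are those just right of \<open>i\<close>, ...,
    \<open>j - 1\<close>.\<close>
  show "\<forall>U\<in>kr n P. unsplit U {i..<j}"
  proof (intro ballI, rule ccontr)
    fix U assume U: "U \<in> kr n P" "\<not> unsplit U {i..<j}"
    then obtain a b where ab: "a \<in> U" "i \<le> a" "a < j" "b \<in> U" "b < i \<or> j \<le> b"
      by (auto elim!: not_unsplitE)
    from ab(5) show False
    proof
      assume "b < i"
      then have "unsplit V {b<..a}"
        using kr_block_iff_le[OF P, of b a] ab U V by auto
      then show False using unsplitD[of V "{b<..a}" i j] V ab \<open>b < i\<close> by auto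
    next
      assume "j \<le> b"
      then have "unsplit V {a<..b}"
        using kr_block_iff_le[OF P, of a b] ab U V by auto
      then show False using unsplitD[of V "{a<..b}" j i] V ab \<open>j \<le> b\<close> by auto
    qed
  qed
next
  assume R: "\<forall>U\<in>kr n P. unsplit U {i..<j}"
  have "i \<in> \<Union>P" using nc_onD(1)[OF P] ij by auto
  then obtain V where V: "V \<in> P" "i \<in> V" by blast
  have fin: "finite V" by (rule nc_on_block_finite[OF P V(1)])
  have Vn: "V \<subseteq> {..<n}" by (rule nc_onD(3)[OF P V(1)])
  have other: "uncrossed V W \<and> uncrossed W V \<and> V \<inter> W = {}" if "W \<in> P" "W \<noteq> V" for W
    using nc_onD(4,5)[OF P] V that by blast
  \<comment> \<open>All cases below end here: an interval that splits no block of \<open>P\<close>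
    has both ends in one block of the complement, and such a block may not contain points both
    inside and outside \<open>{i..<j}\<close>.\<close>
  have contra: False if ab: "a \<le> b" "b < n" "\<And>W. W \<in> P \<Longrightarrow> unsplit W {a<..b}"
    "(a \<in> {i..<j}) \<noteq> (b \<in> {i..<j})" for a b
  proof -
    obtain U where "U \<in> kr n P" "a \<in> U" "b \<in> U"
      using kr_block_iff_le[OF P ab(1)] ab(2,3) by auto
    then show False using R ab(4) unsplitD by metis
  qed
  show "\<exists>V\<in>P. i \<in> V \<and> j \<in> V"
  proof (rule ccontr)
    assume "\<not> (\<exists>V\<in>P. i \<in> V \<and> j \<in> V)"
    then have j: "j \<notin> V" using V by blast
    define v1 where "v1 = Max {v \<in> V. v < j}"
    have "v1 \<in> {v \<in> V. v < j}" unfolding v1_def using fin V ij by (intro Max_in) auto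
    then have v1: "v1 \<in> V" "v1 < j" by auto
    have v1_max: "v \<le> v1" if "v \<in> V" "v < j" for v
      unfolding v1_def using fin that by (intro Max_ge) auto
    have iv1: "i \<le> v1" by (rule v1_max[OF V(2) ij(1)])
    show False
    proof (cases "\<exists>v\<in>V. j < v")
      case True
      define v2 where "v2 = Min {v \<in> V. j < v}"
      have "v2 \<in> {v \<in> V. j < v}" unfolding v2_def using fin True by (intro Min_in) auto
      then have v2: "v2 \<in> V" "j < v2" by auto
      have v2_min: "v2 \<le> v" if "v \<in> V" "j < v" for v
        unfolding v2_def using fin that by (intro Min_le) auto
      \<comment> \<open>The last complement point before \<open>v2\<close> is the one just right of
        \<open>v2 - 1\<close>.\<close>
      have "unsplit W {v1<..v2 - 1}" if W: "W \<in> P" for W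
      proof (cases "W = V")
        case True
        have "x \<notin> {v1<..v2 - 1}" if "x \<in> V" for x
          using v1_max[of x] v2_min[of x] j that v2 by (cases x j rule: linorder_cases) auto
        then show ?thesis unfolding True unsplit_def by blast
      next
        case False
        show ?thesis
        proof (rule ccontr)
          assume "\<not> unsplit W {v1<..v2 - 1}"
          then obtain x y where xy: "x \<in> W" "v1 < x" "x < v2" "y \<in> W" "y \<le> v1 \<or> v2 \<le> y"
            using v2 by (auto elim!: not_unsplitE)
          have "y \<noteq> v1" "y \<noteq> v2" using other[OF W False] v1 v2 xy by blast+
          with xy(5) have "y < v1 \<or> v2 < y" by auto
          then show False
            using other[OF W False] v1(1) v2(1) xy(1-4) unfolding uncrossed_def by metis
        qed
      qed
      moreover have "v2 - 1 < n" using v2(1) Vn by fastforce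
      moreover have "v1 \<le> v2 - 1" "v1 \<in> {i..<j}" "v2 - 1 \<notin> {i..<j}"
        using v1 v2 iv1 by auto
      ultimately show False
        using contra[of v1 "v2 - 1"] by blast
    next
      case False
      have top: "v \<le> v1" if "v \<in> V" for v
        using v1_max[OF that] False j that by (metis linorder_neqE_nat)
      \<comment> \<open>No element of \<open>V\<close> exceeds \<open>j\<close>, so the gap of
        \<open>j\<close> runs from \<open>v1\<close> past the end around to \<open>v0\<close>. Its
        last point lies right of \<open>n - 1\<close> if \<open>v0 = 0\<close>, and right of
        \<open>v0 - 1\<close> otherwise.\<close>
      define v0 where "v0 = Min V"
      have v0: "v0 \<in> V" and v0_min: "\<And>v. v \<in> V \<Longrightarrow> v0 \<le> v"
        unfolding v0_def using fin V nc_on_block_finite(2)[OF P V(1)] by (auto intro: Min_in)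
      show False
      proof (cases "v0 = 0")
        case True
        have "unsplit W {v1<..n - 1}" if W: "W \<in> P" for W
        proof (cases "W = V")
          case True
          then show ?thesis using top unfolding unsplit_def by force
        next
          case False
          show ?thesis
          proof (rule ccontr)
            assume "\<not> unsplit W {v1<..n - 1}"
            then obtain x y where xy: "x \<in> W" "v1 < x" "y \<in> W" "y \<le> v1 \<or> n - 1 < y"
              by (auto elim!: not_unsplitE)
            have "y < n" using xy(3) nc_onD(3)[OF P W] by auto
            moreover have "y \<noteq> v0" "y \<noteq> v1" using other[OF W False] v1 v0 xy by blast+
            ultimately have "v0 < y" "y < v1" using xy(4) True by auto
            then show False
              using other[OF W False] v1(1) v0 xy(1,2,3) unfolding uncrossed_def by metis
          qed
        qed
        moreover have "v1 \<le> n - 1" "n - 1 < n" "v1 \<in> {i..<j}" "n - 1 \<notin> {i..<j}"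
          using v1 iv1 ij by auto
        ultimately show False
          using contra[of v1 "n - 1"] by blast
      next
        case False
        have "unsplit W {v0 - 1<..v1}" if W: "W \<in> P" for W
        proof (cases "W = V")
          case True
          then show ?thesis using top v0_min False unfolding unsplit_def by fastforce
        next
          case ne: False
          show ?thesis
          proof (rule ccontr)
            assume "\<not> unsplit W {v0 - 1<..v1}"
            then obtain x y where xy: "x \<in> W" "v0 \<le> x" "x \<le> v1" "y \<in> W" "y < v0 \<or> v1 < y"
              using False by (auto elim!: not_unsplitE)
            have "x \<noteq> v0" "x \<noteq> v1" using other[OF W ne] v1 v0 xy by blast+
            then have "v0 < x" "x < v1" using xy by auto
            then show False
              using other[OF W ne] v1(1) v0 xy(1,4,5) unfolding uncrossed_def by metis
          qed
        qed
        moreover have "v0 - 1 \<le> v1" "v1 < n" "v1 \<in> {i..<j}" "v0 - 1 \<notin> {i..<j}"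
          using v1 iv1 v0_min[OF V(2)] False ij by auto
        ultimately show False
          using contra[of "v0 - 1" v1] by blast
      qed
    qed
  qed
qed

section \<open>Refinement order under the Kreweras complement\<close>

lemma nc_on_refines_iff:
  assumes P: "P \<in> nc_on A" and Q: "Q \<in> nc_on (A::nat set)"
  shows "(\<forall>V\<in>P. \<exists>W\<in>Q. V \<subseteq> W) \<longleftrightarrow>
    (\<forall>i j. i < j \<longrightarrow> (\<exists>V\<in>P. i \<in> V \<and> j \<in> V) \<longrightarrow> (\<exists>W\<in>Q. i \<in> W \<and> j \<in> W))" (is "?L \<longleftrightarrow> ?R")
proof
  assume ?L then show ?R by (meson subsetD)
next
  assume R: ?R
  show ?L
  proof
    fix V assume V: "V \<in> P"
    then obtain i where i: "i \<in> V" using nc_onD(2)[OF P] by (metis all_not_in_conv)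
    then have "i \<in> \<Union>Q" using nc_onD(1)[OF Q] nc_onD(3)[OF P V] by auto
    then obtain W where W: "W \<in> Q" "i \<in> W" by blast
    have "j \<in> W" if j: "j \<in> V" for j
    proof -
      consider "i < j" | "i = j" | "j < i" by linarith
      then have "\<exists>X\<in>Q. i \<in> X \<and> j \<in> X"
        using R V i j W by cases blast+
      then show ?thesis using nc_on_same_block[OF Q W(1)] W(2) by metis
    qed
    then show "\<exists>W\<in>Q. V \<subseteq> W" using W by blast
  qed
qed

text \<open>On either side, joint membership in a block means that all blocks of the other side are
  \<open>unsplit\<close> by an interval. This property passes from a block to its subsets, so
  coarser blocks on one side impose stronger conditions on the other.\<close>

lemma kr_refines_iff:
  assumes P: "P \<in> nc_on {..<n}" and Q: "Q \<in> nc_on {..<n}"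
  shows "(\<forall>V\<in>kr n Q. \<exists>W\<in>kr n P. V \<subseteq> W) \<longleftrightarrow> (\<forall>V\<in>P. \<exists>W\<in>Q. V \<subseteq> W)"
proof
  assume L: "\<forall>V\<in>kr n Q. \<exists>W\<in>kr n P. V \<subseteq> W"
  show "\<forall>V\<in>P. \<exists>W\<in>Q. V \<subseteq> W"
    unfolding nc_on_refines_iff[OF P Q]
  proof (intro allI impI)
    fix i j :: nat assume ij: "i < j" and V: "\<exists>V\<in>P. i \<in> V \<and> j \<in> V"
    have jn: "j < n" using V nc_onD(3)[OF P] by auto
    have "unsplit U {i..<j}" if "U \<in> kr n Q" for U
    proof -
      obtain W where "W \<in> kr n P" "U \<subseteq> W" using L \<open>U \<in> kr n Q\<close> by blast
      moreover have "unsplit W {i..<j}"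
        using V same_block_iff_kr[OF P ij jn] calculation by blast
      ultimately show ?thesis unfolding unsplit_def by blast
    qed
    then show "\<exists>W\<in>Q. i \<in> W \<and> j \<in> W"
      using same_block_iff_kr[OF Q ij jn] by blast
  qed
next
  assume R: "\<forall>V\<in>P. \<exists>W\<in>Q. V \<subseteq> W"
  show "\<forall>V\<in>kr n Q. \<exists>W\<in>kr n P. V \<subseteq> W"
    unfolding nc_on_refines_iff[OF kr_in_nc_on[OF Q] kr_in_nc_on[OF P]]
  proof (intro allI impI)
    fix i j :: nat assume ij: "i < j" and V: "\<exists>V\<in>kr n Q. i \<in> V \<and> j \<in> V"
    have "unsplit U {i<..j}" if "U \<in> P" for U
    proof -
      obtain W where "W \<in> Q" "U \<subseteq> W" using R \<open>U \<in> P\<close> by blast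
      moreover have "unsplit W {i<..j}"
        using V kr_block_iff_le[OF Q less_imp_le[OF ij]] calculation by blast
      ultimately show ?thesis unfolding unsplit_def by blast
    qed
    then show "\<exists>W\<in>kr n P. i \<in> W \<and> j \<in> W"
      using V kr_block_iff_le[OF Q less_imp_le[OF ij]] kr_block_iff_le[OF P less_imp_le[OF ij]] by blast
  qed
qed

lemma nc_on_refines_antisym:
  assumes P: "P \<in> nc_on A" and Q: "Q \<in> nc_on A"
    and "\<forall>V\<in>P. \<exists>W\<in>Q. V \<subseteq> W" "\<forall>V\<in>Q. \<exists>W\<in>P. V \<subseteq> W"
  shows "P = Q"
  using assms by (intro refines_asym[of A]) (auto simp: refines_def nc_on_def)

text \<open>Order reversal in both directions yields injectivity, and a finite set maps injectively
  into itself only by a bijection.\<close>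

lemma bij_betw_kr: "bij_betw (kr n) (nc_on {..<n}) (nc_on {..<n})"
proof -
  have inj: "inj_on (kr n) (nc_on {..<n})"
  proof (rule inj_onI)
    fix P Q assume PQ: "P \<in> nc_on {..<n}" "Q \<in> nc_on {..<n}" "kr n P = kr n Q"
    have "\<forall>V\<in>kr n P. \<exists>W\<in>kr n P. V \<subseteq> W" by blast
    then show "P = Q"
      using PQ kr_refines_iff[OF PQ(1,2)] kr_refines_iff[OF PQ(2,1)]
      by (intro nc_on_refines_antisym[of P "{..<n}" Q]) auto
  qed
  moreover have "kr n ` nc_on {..<n} = nc_on {..<n}"
    by (rule endo_inj_surj[OF _ _ inj]) (auto intro: kr_in_nc_on finite_nc_on)
  ultimately show ?thesis by (simp add: bij_betw_def)
qed

lemma kr_top: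
  assumes "0 < n"
  shows "kr n {{..<n}} = (\<lambda>i. {i}) ` {..<n}"
proof -
  have top: "{{..<n}} \<in> nc_on {..<n}"
    using assms by (intro nc_onI) auto
  have single: "i = j" if "U \<in> kr n {{..<n}}" "i \<in> U" "j \<in> U" for U i j
  proof -
    have "i < n" "j < n" and key: "key {..<n} i = key {..<n} j"
      using kr_block_iff[of n "{{..<n}}" i j] that by auto
    then have "{v \<in> {..<n}. v \<le> i} = {..i}" "{v \<in> {..<n}. v \<le> j} = {..j}" by auto
    \<comment> \<open>With respect to the full block the key is \<open>Suc i mod n\<close>, which is
      0 only for the last position; distinct positions thus have distinct keys.\<close>
    then have "Suc i mod n = Suc j mod n" using key by (simp add: key_def)
    then show ?thesis
      using \<open>i < n\<close> \<open>j < n\<close> by (auto simp: mod_Suc split: if_splits)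
  qed
  show ?thesis
  proof (rule nc_on_refines_antisym)
    show "kr n {{..<n}} \<in> nc_on {..<n}" by (rule kr_in_nc_on[OF top])
    show "(\<lambda>i. {i}) ` {..<n} \<in> nc_on {..<n}"
      by (intro nc_onI) (auto simp: uncrossed_def)
    show "\<forall>V\<in>kr n {{..<n}}. \<exists>W\<in>(\<lambda>i. {i}) ` {..<n}. V \<subseteq> W"
    proof
      fix V assume V: "V \<in> kr n {{..<n}}"
      then obtain i where i: "i \<in> V" using nc_onD(2)[OF kr_in_nc_on[OF top]] by (metis all_not_in_conv)
      then have "V \<subseteq> {i}" using single[OF V i] by blast
      moreover have "i < n" using nc_onD(3)[OF kr_in_nc_on[OF top] V] i by auto
      ultimately show "\<exists>W\<in>(\<lambda>i. {i}) ` {..<n}. V \<subseteq> W" by blast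
    qed
    show "\<forall>V\<in>(\<lambda>i. {i}) ` {..<n}. \<exists>W\<in>kr n {{..<n}}. V \<subseteq> W"
    proof
      fix V assume "V \<in> (\<lambda>i. {i}) ` {..<n}"
      then obtain i where i: "V = {i}" "i < n" by auto
      then have "\<exists>U\<in>kr n {{..<n}}. i \<in> U \<and> i \<in> U"
        unfolding kr_block_iff by simp
      then show "\<exists>W\<in>kr n {{..<n}}. V \<subseteq> W" using i(1) by blast
    qed
  qed
qed

section \<open>The \<open>R\<close>-transform and its inverse\<close>

text \<open>The moments with free cumulants \<open>\<xi>\<close>. The empty partition gives the
  value 1 at the empty word, which is the factor wanted for an empty gap.\<close>

definition mom :: "('s list \<Rightarrow> 'k::comm_ring_1) \<Rightarrow> 's list \<Rightarrow> 'k" where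
  "mom \<xi> w = nc_sum (\<lambda>V. \<xi> (nths w V)) {..<length w}"

lemma length_nths_subset: "A \<subseteq> {..<length w} \<Longrightarrow> length (nths w A) = card A"
  by (auto simp: length_nths intro!: arg_cong[where f = card])

lemma nths_nonempty: "A \<subseteq> {..<length w} \<Longrightarrow> A \<noteq> {} \<Longrightarrow> nths w A \<noteq> []"
  using length_nths_subset[of A w] finite_subset[of A "{..<length w}"] by auto

text \<open>Only the relative order of positions matters, so \<open>A\<close> may be renumbered by
  the ranks \<open>r\<close> of its elements, their positions in the subword.\<close>

lemma nc_sum_nths:
  assumes A: "A \<subseteq> {..<length w}"
  shows "nc_sum (\<lambda>V. \<xi> (nths w V)) A = mom \<xi> (nths w A)"
proof -
  have fin: "finite A" using A finite_subset by blast
  define r where "r i = card {i' \<in> A. i' < i}" for i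
  have sm: "strict_mono_on A r"
  proof (rule strict_mono_onI)
    fix i j assume "i \<in> A" "j \<in> A" "i < j"
    then show "r i < r j"
      unfolding r_def using fin by (intro psubset_card_mono) auto
  qed
  have "r ` A \<subseteq> {..<card A}"
    unfolding r_def using fin by (auto intro!: psubset_card_mono)
  then have rA: "r ` A = {..<card A}"
    using card_image[OF strict_mono_on_imp_inj_on[OF sm]] by (intro card_subset_eq) auto
  have "mom \<xi> (nths w A) = nc_sum (\<lambda>V. \<xi> (nths (nths w A) V)) (r ` A)"
    by (simp add: mom_def length_nths_subset[OF A] rA)
  also have "\<dots> = nc_sum (\<lambda>V. \<xi> (nths (nths w A) (r ` V))) A"
    by (rule nc_sum_image[OF sm])
  also have "\<dots> = nc_sum (\<lambda>V. \<xi> (nths w V)) A"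
  proof (rule nc_sum_cong)
    fix V assume V: "V \<subseteq> A" "V \<noteq> {}"
    have "{i \<in> A. \<exists>j\<in>r ` V. r i = j} = V"
      using V inj_onD[OF strict_mono_on_imp_inj_on[OF sm]] by blast
    then show "\<xi> (nths (nths w A) (r ` V)) = \<xi> (nths w V)"
      by (simp add: nths_nths r_def)
  qed
  finally show ?thesis ..
qed

lemma mom_Nil [simp]: "mom \<xi> [] = 1"
  by (simp add: mom_def)

section \<open>Triangularity of the moment-cumulant relation\<close>

lemma top_in_nc_on: "A \<noteq> {} \<Longrightarrow> {A} \<in> nc_on A"
  by (intro nc_onI) auto

lemma nc_on_psubset:
  assumes P: "P \<in> nc_on A" "P \<noteq> {A}" and V: "V \<in> P"
  shows "V \<subset> A"
proof -
  have "V \<noteq> A"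
  proof
    assume VA: "V = A"
    have "W = V" if "W \<in> P" for W
      using nc_onD(2,3)[OF P(1)] nc_onD(4)[OF P(1) that V] that VA by (metis inf.absorb1)
    with V VA P(2) show False by blast
  qed
  then show ?thesis using nc_onD(3)[OF P(1) V] by auto
qed

text \<open>All partitions in the remaining sum involve shorter words only, so the relation can be
  solved for \<open>\<xi> w\<close>: this yields injectivity and a recursion for the
  inverse.\<close>

lemma mom_split:
  assumes "w \<noteq> []"
  shows "mom \<xi> w = \<xi> w + (\<Sum>P\<in>NC (length w) - {{{..<length w}}}. \<Prod>V\<in>P. \<xi> (nths w V))"
proof -
  have top: "{{..<length w}} \<in> nc_on {..<length w}"
    using assms by (intro top_in_nc_on) auto
  show ?thesis
    unfolding mom_def nc_sum_def NC_eq_nc_on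
    by (subst sum.remove[OF finite_nc_on top]) (simp_all add: nths_all)
qed

lemma length_nths_NC_less:
  assumes "P \<in> NC (length w)" "P \<noteq> {{..<length w}}" "V \<in> P"
  shows "length (nths w V) < length w" "nths w V \<noteq> []"
proof -
  have P: "P \<in> nc_on {..<length w}" using assms by (simp add: NC_eq_nc_on)
  have V: "V \<subset> {..<length w}" by (rule nc_on_psubset[OF P assms(2,3)])
  then have "card V < card {..<length w}" by (intro psubset_card_mono) auto
  with V show "length (nths w V) < length w" by (simp add: length_nths_subset)
  show "nths w V \<noteq> []"
    using V nc_onD(2)[OF P] assms(3) by (intro nths_nonempty) auto
qed

lemma mom_inject:
  assumes "\<And>w. w \<noteq> [] \<Longrightarrow> mom \<xi> w = mom \<xi>' w" "w \<noteq> []"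
  shows "\<xi> w = \<xi>' w"
  using assms(2)
proof (induction w rule: length_induct)
  case (1 w)
  have "(\<Prod>V\<in>P. \<xi> (nths w V)) = (\<Prod>V\<in>P. \<xi>' (nths w V))"
    if "P \<in> NC (length w) - {{{..<length w}}}" for P
    using that length_nths_NC_less[of P w] "1.IH" by (intro prod.cong) auto
  then show ?case
    using assms(1)[OF "1.prems"] unfolding mom_split[OF "1.prems"] by simp
qed

text \<open>The inverse of \<open>mom\<close> by recursion on length, independent of Moebius
  inversion. It supplies the existence of \<open>Moeb\<close> and a preimage of every series under
  \<open>EXP\<close>.\<close>

function cum :: "('s list \<Rightarrow> 'k::comm_ring_1) \<Rightarrow> 's list \<Rightarrow> 'k" where
  "cum f w = (if w = [] then 0 else
     f w - (\<Sum>P\<in>NC (length w) - {{{..<length w}}}. \<Prod>V\<in>P. cum f (nths w V)))"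
  by pat_completeness auto
termination
  by (relation "measure (\<lambda>(f, w). length w)") (auto intro: length_nths_NC_less(1))

declare cum.simps [simp del]

lemma cum_Nil [simp]: "cum f [] = 0"
  by (simp add: cum.simps)

lemma mom_cum: "w \<noteq> [] \<Longrightarrow> mom (cum f) w = f w"
  by (simp add: mom_split cum.simps[of f w])

lemma mom_single: "mom \<xi> [i] = \<xi> [i]"
proof -
  have "NC 1 - {{{..<1}}} = {}"
  proof -
    have "P = {{..<1}}" if P: "P \<in> nc_on {..<1::nat}" for P
    proof (rule ccontr)
      assume ne: "P \<noteq> {{..<1}}"
      have "\<Union>P \<noteq> {}" using nc_onD(1)[OF P] by auto
      then obtain V where V: "V \<in> P" by blast
      show False
        using nc_on_psubset[OF P ne V] nc_onD(2)[OF P] V by (auto simp: lessThan_Suc psubset_eq subset_singleton_iff)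
    qed
    then show ?thesis by (auto simp: NC_eq_nc_on)
  qed
  then have "NC (length [i]) - {{{..<length [i]}}} = {}"
    by simp
  from this show ?thesis
    unfolding mom_split[OF list.distinct(2)] by (simp only: sum.empty add_0_right)
qed

section \<open>Boxed convolution with the zeta and Moebius series\<close>

lemma nths_block_nonempty:
  assumes "P \<in> nc_on {..<length w}" "V \<in> P"
  shows "nths w V \<noteq> []"
  using nc_onD(2,3)[OF assms(1)] assms(2) by (intro nths_nonempty) auto

lemma coeff_part_Zeta:
  assumes "P \<in> nc_on {..<length w}"
  shows "coeff_part Zeta w P = 1"
  using nths_block_nonempty[OF assms] by (simp add: coeff_part_def Zeta_def)

lemma boxconv_Zeta:
  assumes "w \<noteq> []"
  shows "(g \<boxtimes> Zeta) w = mom g w"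
  using assms unfolding boxconv_def mom_def nc_sum_def NC_eq_nc_on
  by (auto intro!: sum.cong simp: kreweras_eq_kr NC_eq_nc_on coeff_part_Zeta kr_in_nc_on coeff_part_def[of g])

text \<open>Here the blocks of the complement carry \<open>g\<close>; as the complement permutes the
  non-crossing partitions, reindexing gives the same sum as with \<open>Zeta\<close> on the
  right.\<close>

lemma Zeta_boxconv:
  assumes "w \<noteq> []"
  shows "(Zeta \<boxtimes> g) w = mom g w"
proof -
  let ?N = "nc_on {..<length w}"
  have "(Zeta \<boxtimes> g) w = (\<Sum>P\<in>?N. coeff_part g w (kr (length w) P))"
    using assms unfolding boxconv_def NC_eq_nc_on
    by (auto intro!: sum.cong simp: kreweras_eq_kr NC_eq_nc_on coeff_part_Zeta)
  also have "\<dots> = (\<Sum>P\<in>?N. coeff_part g w P)"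
    by (rule sum.reindex_bij_betw[OF bij_betw_kr])
  also have "\<dots> = mom g w"
    by (simp add: mom_def nc_sum_def coeff_part_def)
  finally show ?thesis .
qed

text \<open>Both products with \<open>Zeta\<close> are \<open>mom\<close>, so both conditions say
  that the moments are \<open>boxunit\<close>; \<open>cum\<close> solves this equation and
  \<open>mom_inject\<close> makes the solution unique.\<close>

lemma Moeb_eq_cum: "(Moeb :: 's list \<Rightarrow> 'k::field) = cum boxunit"
  unfolding Moeb_def
proof (rule the_equality)
  let ?m = "cum boxunit :: 's list \<Rightarrow> 'k"
  have m: "mom ?m w = boxunit w" if "w \<noteq> []" for w
    using that by (rule mom_cum)
  have "?m [i] = 1" for i
    using m[of "[i]"] by (simp add: mom_single boxunit_def)
  then have "?m \<in> boxgroup"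
    by (simp add: boxgroup_def ncseries_def)
  moreover have "Zeta \<boxtimes> ?m = boxunit"
  proof
    fix w show "(Zeta \<boxtimes> ?m) w = boxunit w"
      by (cases "w = []") (simp_all add: Zeta_boxconv m, simp add: boxconv_def boxunit_def)
  qed
  moreover have "?m \<boxtimes> Zeta = boxunit"
  proof
    fix w show "(?m \<boxtimes> Zeta) w = boxunit w"
      by (cases "w = []") (simp_all add: boxconv_Zeta m, simp add: boxconv_def boxunit_def)
  qed
  ultimately show "?m \<in> boxgroup \<and> Zeta \<boxtimes> ?m = boxunit \<and> ?m \<boxtimes> Zeta = boxunit"
    by blast
  fix g :: "'s list \<Rightarrow> 'k"
  assume g: "g \<in> boxgroup \<and> Zeta \<boxtimes> g = boxunit \<and> g \<boxtimes> Zeta = boxunit"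
  have eq: "g w = ?m w" if "w \<noteq> []" for w
  proof (rule mom_inject[OF _ that])
    fix v :: "'s list" assume "v \<noteq> []"
    then show "mom g v = mom ?m v"
      using g m Zeta_boxconv[of v g] by simp
  qed
  have "g [] = 0" using g by (simp add: boxgroup_def ncseries_def)
  then show "g = ?m"
    using eq by (intro ext) (metis cum_Nil)
qed

lemma mom_Moeb: "w \<noteq> [] \<Longrightarrow> mom Moeb w = boxunit w"
  by (simp add: Moeb_eq_cum mom_cum)

lemma Moeb_single: "Moeb [i] = 1"
  using mom_Moeb[of "[i]"] by (simp add: mom_single boxunit_def)

text \<open>Choosing a non-crossing partition of every block of \<open>P\<close> is choosing one
  refinement \<open>S\<close> of \<open>P\<close>: the blocks are pairwise uncrossed, so the pieces
  fit together.\<close>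

lemma prod_nc_sum_refines:
  assumes P: "P \<in> nc_on A" and fin: "finite A"
  shows "(\<Prod>V\<in>P. nc_sum h V) =
    (\<Sum>S\<in>nc_on A. if \<forall>U\<in>S. \<exists>V\<in>P. U \<subseteq> V then \<Prod>U\<in>S. h U else 0)"
proof -
  have "(\<Prod>V\<in>P. nc_sum h V) = nc_sum (\<lambda>U. if \<exists>V\<in>P. U \<subseteq> V then h U else 0) (\<Union>V\<in>P. V)"
    using nc_onD(3-5)[OF P] finite_nc_on_elem[OF fin P] finite_subset[OF _ fin]
    by (intro prod_nc_sum) auto
  also have "(\<Union>V\<in>P. V) = A"
    using nc_onD(1)[OF P] by simp
  also have "nc_sum (\<lambda>U. if \<exists>V\<in>P. U \<subseteq> V then h U else 0) A =
      (\<Sum>S\<in>nc_on A. if \<forall>U\<in>S. \<exists>V\<in>P. U \<subseteq> V then \<Prod>U\<in>S. h U else 0)"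
    unfolding nc_sum_def
  proof (rule sum.cong[OF refl])
    fix S assume S: "S \<in> nc_on A"
    show "(\<Prod>U\<in>S. if \<exists>V\<in>P. U \<subseteq> V then h U else 0) =
        (if \<forall>U\<in>S. \<exists>V\<in>P. U \<subseteq> V then \<Prod>U\<in>S. h U else 0)"
    proof (cases "\<forall>U\<in>S. \<exists>V\<in>P. U \<subseteq> V")
      case True
      then show ?thesis by simp
    next
      case False
      then have "(\<Prod>U\<in>S. if \<exists>V\<in>P. U \<subseteq> V then h U else 0) = 0"
        using finite_nc_on_elem[OF fin S] by (intro prod_zero) auto
      then show ?thesis using False by auto
    qed
  qed
  finally show ?thesis .
qed

text \<open>\<open>boxunit\<close> detects words of length 1, so the product survives only if the
  complement consists of singletons. By \<open>kr_top\<close> and injectivity this happens only for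
  the one-block partition.\<close>

lemma prod_boxunit_kr:
  assumes S: "S \<in> nc_on {..<length w}" and w: "w \<noteq> []"
  shows "(\<Prod>B\<in>kr (length w) S. boxunit (nths w B)) =
    (if S = {{..<length w}} then 1 else (0::'k::comm_ring_1))"
proof -
  let ?n = "length w"
  have K: "kr ?n S \<in> nc_on {..<?n}" by (rule kr_in_nc_on[OF S])
  have unit: "boxunit (nths w B) = (if card B = 1 then 1 else (0::'k))" if "B \<in> kr ?n S" for B
    using nc_onD(3)[OF K that] by (simp add: boxunit_def length_nths_subset)
  show ?thesis
  proof (cases "S = {{..<?n}}")
    case True
    have "kr ?n S = (\<lambda>i. {i}) ` {..<?n}"
      using kr_top[of ?n] w True by simp
    then show ?thesis using True unit by (auto intro!: prod.neutral)
  next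
    case False
    have "\<exists>B\<in>kr ?n S. card B \<noteq> 1"
    proof (rule ccontr)
      assume *: "\<not> (\<exists>B\<in>kr ?n S. card B \<noteq> 1)"
      have single: "B = {i}" if "B \<in> kr ?n S" "i \<in> B" for B i
        using * that by (metis card_1_singletonE singletonD)
      have "kr ?n S = (\<lambda>i. {i}) ` {..<?n}"
      proof (intro set_eqI iffI)
        fix B assume B: "B \<in> kr ?n S"
        then obtain i where i: "i \<in> B" using nc_onD(2)[OF K] by (metis all_not_in_conv)
        then show "B \<in> (\<lambda>i. {i}) ` {..<?n}"
          using single[OF B i] nc_onD(3)[OF K B] by blast
      next
        fix B assume "B \<in> (\<lambda>i. {i}) ` {..<?n}"
        then obtain i where i: "B = {i}" "i < ?n" by auto
        then have "i \<in> \<Union>(kr ?n S)" using nc_onD(1)[OF K] by auto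
        then show "B \<in> kr ?n S" using single i(1) by (metis UnionE)
      qed
      then have "kr ?n S = kr ?n {{..<?n}}"
        using kr_top[of ?n] w by simp
      moreover have "{{..<?n}} \<in> nc_on {..<?n}" using w by (intro top_in_nc_on) auto
      ultimately show False
        using False S bij_betw_imp_inj_on[OF bij_betw_kr] by (meson inj_onD)
    qed
    then have "(\<Prod>B\<in>kr ?n S. if card B = 1 then 1 else (0::'k)) = 0"
      using finite_nc_on_elem[OF _ K] by (intro prod_zero) auto
    then show ?thesis using unit False by simp
  qed
qed

text \<open>Moebius inversion. Expanding the moments gives a sum over pairs of \<open>P\<close> and
  a refinement \<open>S\<close>. For fixed \<open>S\<close>, the complements of the \<open>P\<close>
  above it are exactly the refinements of the complement of \<open>S\<close>; the inner sum is
  therefore a product of \<open>mom Moeb\<close>, that is of \<open>boxunit\<close>, over the blocks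
  of that complement, and only the one-block \<open>S\<close> remains.\<close>

lemma R_transform_mom:
  fixes \<xi> :: "'s list \<Rightarrow> 'k::field"
  assumes f: "\<And>v. v \<noteq> [] \<Longrightarrow> f v = mom \<xi> v" and w: "w \<noteq> []"
  shows "R_transform f w = \<xi> w"
proof -
  let ?n = "length w" and ?N = "nc_on {..<length w}"
  let ?le = "\<lambda>S P. \<forall>U\<in>S. \<exists>V\<in>P. U \<subseteq> (V::nat set)"
  let ?x = "\<lambda>S. \<Prod>U\<in>S. \<xi> (nths w U)"
  let ?m = "\<lambda>S. \<Prod>U\<in>S. (Moeb (nths w U) :: 'k)"
  have mom_prod: "(\<Prod>V\<in>P. mom \<zeta> (nths w V)) = (\<Sum>S\<in>?N. if ?le S P then \<Prod>U\<in>S. \<zeta> (nths w U) else 0)"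
    if P: "P \<in> ?N" for P and \<zeta> :: "'s list \<Rightarrow> 'k"
  proof -
    have "(\<Prod>V\<in>P. mom \<zeta> (nths w V)) = (\<Prod>V\<in>P. nc_sum (\<lambda>U. \<zeta> (nths w U)) V)"
      using nc_onD(3)[OF P] by (intro prod.cong) (simp_all add: nc_sum_nths)
    then show ?thesis by (simp add: prod_nc_sum_refines[OF P])
  qed
  have inner: "(\<Sum>P\<in>?N. if ?le S P then ?m (kr ?n P) else 0) = (if S = {{..<?n}} then 1 else 0)"
    if S: "S \<in> ?N" for S
  proof -
    have "(\<Sum>P\<in>?N. if ?le S P then ?m (kr ?n P) else 0) =
        (\<Sum>P\<in>?N. if ?le (kr ?n P) (kr ?n S) then ?m (kr ?n P) else 0)"
      using kr_refines_iff[OF S] by (intro sum.cong) auto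
    also have "\<dots> = (\<Sum>Q\<in>?N. if ?le Q (kr ?n S) then ?m Q else 0)"
      by (rule sum.reindex_bij_betw[OF bij_betw_kr])
    also have "\<dots> = (\<Prod>V\<in>kr ?n S. mom Moeb (nths w V))"
      by (rule mom_prod[OF kr_in_nc_on[OF S], of Moeb, symmetric])
    also have "\<dots> = (\<Prod>V\<in>kr ?n S. boxunit (nths w V))"
      using nths_block_nonempty[OF kr_in_nc_on[OF S]] by (intro prod.cong) (simp_all add: mom_Moeb)
    also have "\<dots> = (if S = {{..<?n}} then 1 else 0)"
      by (rule prod_boxunit_kr[OF S w])
    finally show ?thesis .
  qed
  have if_mult: "(if c then a else 0) * b = a * (if c then b else 0)" for a b :: 'k and c
    by simp
  have "R_transform f w = (\<Sum>P\<in>?N. (\<Prod>V\<in>P. mom \<xi> (nths w V)) * ?m (kr ?n P))"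
    using w f nths_block_nonempty
    by (auto simp: R_transform_def boxconv_def NC_eq_nc_on kreweras_eq_kr coeff_part_def
        intro!: sum.cong arg_cong2[where f = "(*)"] prod.cong)
  also have "\<dots> = (\<Sum>P\<in>?N. \<Sum>S\<in>?N. ?x S * (if ?le S P then ?m (kr ?n P) else 0))"
  proof (rule sum.cong[OF refl])
    fix P assume P: "P \<in> ?N"
    show "(\<Prod>V\<in>P. mom \<xi> (nths w V)) * ?m (kr ?n P) =
        (\<Sum>S\<in>?N. ?x S * (if ?le S P then ?m (kr ?n P) else 0))"
      unfolding mom_prod[OF P] sum_distrib_right
      by (rule sum.cong[OF refl], rule if_mult)
  qed
  also have "\<dots> = (\<Sum>S\<in>?N. ?x S * (\<Sum>P\<in>?N. if ?le S P then ?m (kr ?n P) else 0))"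
    by (subst sum.swap) (simp add: sum_distrib_left)
  also have "\<dots> = (\<Sum>S\<in>?N. if S = {{..<?n}} then ?x S else 0)"
    using inner by (intro sum.cong) simp_all
  also have "\<dots> = \<xi> w"
    using top_in_nc_on[of "{..<?n}"] w by (subst sum.delta) (auto simp: finite_nc_on nths_all)
  finally show ?thesis .
qed

section \<open>The linear part of the free product\<close>

text \<open>
  The letters \<open>x\<close> of a monomial, each with the number of letters \<open>y\<close> (plus \<open>m\<close>) that precede it;
  modulo the total number of letters \<open>y\<close> this is the number of its cyclic gap.
\<close>

fun gap_index :: "nat \<Rightarrow> ('s + 's) list \<Rightarrow> (nat \<times> 's) list" where
  "gap_index m [] = []"
| "gap_index m (Inl x # u) = (m, x) # gap_index m u"
| "gap_index m (Inr y # u) = gap_index (Suc m) u"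

definition ys :: "('s + 's) list \<Rightarrow> 's list" where
  "ys u = map projr (filter (\<lambda>z. \<not> isl z) u)"

definition gapword :: "nat \<Rightarrow> nat \<Rightarrow> ('s + 's) list \<Rightarrow> 's list" where
  "gapword k c u = map snd (filter (\<lambda>p. fst p mod k = c) (gap_index 0 u))"

definition linear_part :: "('s list \<Rightarrow> 'k::comm_ring_1) \<Rightarrow> ('s list \<Rightarrow> 'k) \<Rightarrow> ('s + 's) list \<Rightarrow> 'k" where
  "linear_part f g u = (if ys u = [] then 0
     else g (ys u) * (\<Prod>c<length (ys u). (f([] := 1)) (gapword (length (ys u)) c u)))"

lemma ys_Nil [simp]: "ys [] = []"
  and ys_append [simp]: "ys (u @ v) = ys u @ ys v"
  and ys_Inl [simp]: "ys (Inl x # u) = ys u"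
  and ys_Inr [simp]: "ys (Inr x # u) = x # ys u"
  by (simp_all add: ys_def)

lemma ys_x: "\<forall>z\<in>set u. isl z \<Longrightarrow> ys u = []"
  by (simp add: ys_def)

lemma ys_y: "\<forall>z\<in>set u. \<not> isl z \<Longrightarrow> ys u = map projr u"
  by (simp add: ys_def)

lemma gap_index_append: "gap_index m (u @ v) = gap_index m u @ gap_index (m + length (ys u)) v"
  by (induction m u rule: gap_index.induct) auto

lemma gap_index_x: "\<forall>z\<in>set u. isl z \<Longrightarrow> gap_index m u = map (\<lambda>z. (m, projl z)) u"
  by (induction m u rule: gap_index.induct) auto

lemma gap_index_y: "\<forall>z\<in>set u. \<not> isl z \<Longrightarrow> gap_index m u = []"
  by (induction m u rule: gap_index.induct) auto

lemma gap_index_bounds: "p \<in> set (gap_index m u) \<Longrightarrow> m \<le> fst p \<and> fst p \<le> m + length (ys u)"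
  by (induction m u rule: gap_index.induct) auto

text \<open>A run of x's enclosed by y's fills one cyclic gap alone, and this is not the wrap-around
  gap 0. Its removal leaves that gap empty, with factor 1, and all others unchanged.\<close>

lemma linear_part_remove_x_run:
  assumes x: "x \<noteq> []" "\<forall>z\<in>set x. isl z"
    and p: "p \<noteq> []" "\<not> isl (last p)" and q: "q \<noteq> []" "\<not> isl (hd q)"
  shows "linear_part f g (p @ x @ q) = f (map projl x) * linear_part f g (p @ q)"
proof -
  obtain p' a where p': "p = p' @ [Inr a]"
    using p by (metis append_butlast_last_id sum.collapse(2))
  obtain q' b where q': "q = Inr b # q'"
    using q by (metis list.collapse sum.collapse(2))
  define n where "n = length (ys p)"
  define k where "k = length (ys (p @ q))"
  have ysx: "ys (p @ x @ q) = ys (p @ q)"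
    using x by (simp add: ys_x)
  have n: "0 < n" "n < k"
    unfolding n_def k_def p' q' by auto
  have pb: "fst z mod k \<noteq> n" if "z \<in> set (gap_index 0 p)" for z
    using gap_index_bounds[of z 0 p'] that n unfolding n_def k_def p' by (auto simp: gap_index_append)
  \<comment> \<open>Letters after the last y have index \<open>k\<close>, which wraps to 0 and so
    differs from \<open>n\<close>.\<close>
  have qb: "fst z mod k \<noteq> n" if "z \<in> set (gap_index n q)" for z
  proof -
    have "Suc n \<le> fst z" "fst z \<le> k"
      using gap_index_bounds[of z "Suc n" q'] that unfolding q' n_def k_def by auto
    then show ?thesis using n by (cases "fst z = k") auto
  qed
  have ann1: "gap_index 0 (p @ x @ q) = gap_index 0 p @ map (\<lambda>z. (n, projl z)) x @ gap_index n q"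
    using x by (simp add: gap_index_append gap_index_x ys_x n_def)
  have ann2: "gap_index 0 (p @ q) = gap_index 0 p @ gap_index n q"
    by (simp add: gap_index_append n_def)
  have fil: "filter (\<lambda>p. fst p mod k = n) (gap_index 0 p) = []" "filter (\<lambda>p. fst p mod k = n) (gap_index n q) = []"
    using pb qb by (auto simp: filter_empty_conv)
  have g1: "gapword k n (p @ x @ q) = map projl x" and g2: "gapword k n (p @ q) = []"
    unfolding gapword_def ann1 ann2 using fil n by (simp_all add: filter_map o_def)
  have g3: "gapword k c (p @ x @ q) = gapword k c (p @ q)" if "c \<noteq> n" for c
    unfolding gapword_def ann1 ann2 using that n by (simp add: filter_map o_def)
  let ?f = "f([] := 1)"
  have "(\<Prod>c<k. ?f (gapword k c (p @ x @ q))) =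
      ?f (map projl x) * (\<Prod>c\<in>{..<k} - {n}. ?f (gapword k c (p @ q)))"
    using n g1 g3 by (subst prod.remove[of _ n]) (auto intro!: prod.cong)
  also have "\<dots> = f (map projl x) * (\<Prod>c<k. ?f (gapword k c (p @ q)))"
    using n g2 x by (subst (2) prod.remove[of _ n]) auto
  finally show ?thesis
    unfolding linear_part_def ysx k_def[symmetric] by (simp add: mult_ac)
qed

text \<open>The x's before the only run of y's have index 0, those after it index \<open>k\<close>:
  cyclically both lie in gap 0, and the gaps between adjacent y's are empty.\<close>

lemma linear_part_single_y_run:
  assumes y: "y \<noteq> []" "\<forall>z\<in>set y. \<not> isl z"
    and p: "\<forall>z\<in>set p. isl z" and q: "\<forall>z\<in>set q. isl z"
  shows "linear_part f g (p @ y @ q) = g (map projr y) * (f([] := 1)) (map projl (p @ q))"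
proof -
  define k where "k = length y"
  have k: "0 < k" using y by (simp add: k_def)
  have ysu: "ys (p @ y @ q) = map projr y"
    using assms by (simp add: ys_x ys_y)
  have annu: "gap_index 0 (p @ y @ q) = map (\<lambda>z. (0, projl z)) p @ map (\<lambda>z. (k, projl z)) q"
    using assms by (simp add: gap_index_append gap_index_x gap_index_y ys_x ys_y k_def)
  have g0: "gapword k 0 (p @ y @ q) = map projl (p @ q)"
    unfolding gapword_def annu by (simp add: filter_map o_def)
  have g1: "gapword k c (p @ y @ q) = []" if "c \<noteq> 0" for c
    unfolding gapword_def annu using that by (simp add: filter_map o_def)
  let ?f = "f([] := 1)"
  have "(\<Prod>c<k. ?f (gapword k c (p @ y @ q))) = ?f (map projl (p @ q))"
    using k g0 g1 by (subst prod.remove[of _ 0]) (auto intro!: prod.neutral)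
  then show ?thesis
    using y unfolding linear_part_def ysu by (simp add: k_def)
qed

section \<open>The degree-one recursion over alternating factors\<close>

lemma runs_same_side:
  "b \<in> set (runs u) \<Longrightarrow> b \<noteq> [] \<and> (\<forall>z\<in>set b. isl z = isl (hd b))"
proof (induction u rule: runs.induct)
  case (2 z u)
  show ?case
  proof (cases "b = z # takeWhile (\<lambda>y. isl y = isl z) u")
    case True
    have "isl y = isl z" if "y \<in> set b" for y
    proof -
      have "y = z \<or> y \<in> set (takeWhile (\<lambda>y. isl y = isl z) u)"
        using that True by simp
      then show ?thesis using set_takeWhileD[of y "\<lambda>y. isl y = isl z" u] by blast
    qed
    moreover have "hd b = z" "b \<noteq> []" using True by simp_all
    ultimately show ?thesis by blast
  next
    case False
    with 2(2) have "b \<in> set (runs (dropWhile (\<lambda>y. isl y = isl z) u))" by simp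
    then show ?thesis by (rule 2(1))
  qed
qed simp

lemma hd_hd_runs: "u \<noteq> [] \<Longrightarrow> hd (hd (runs u)) = hd u"
  by (cases u) auto

lemma runs_alternate:
  "Suc i < length (runs u) \<Longrightarrow> isl (hd (runs u ! i)) \<noteq> isl (hd (runs u ! Suc i))"
proof (induction u arbitrary: i rule: runs.induct)
  case (2 z u)
  let ?v = "dropWhile (\<lambda>y. isl y = isl z) u"
  show ?case
  proof (cases i)
    case 0
    have ne: "runs ?v \<noteq> []" using 2(2) by auto
    then have v: "?v \<noteq> []" by (metis runs.simps(1))
    then have "isl (hd ?v) \<noteq> isl z"
      using hd_dropWhile[of "\<lambda>y. isl y = isl z" u] by blast
    then show ?thesis
      using 0 hd_hd_runs[OF v] ne by (simp add: hd_conv_nth)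
  next
    case (Suc j)
    then show ?thesis using 2 by simp
  qed
qed simp

text \<open>The subsets of \<open>A\<close> fall into pairs \<open>I\<close>,
  \<open>insert r I\<close> with opposite signs, so the sum over all of them is 0; the term
  \<open>I = A\<close>, absent on the left, has sign -1.\<close>

lemma alternating_sum_toggle:
  fixes E :: "'i set \<Rightarrow> 'k::comm_ring_1"
  assumes fin: "finite A" and r: "r \<in> A"
    and toggle: "\<And>I. I \<subseteq> A - {r} \<Longrightarrow> E (insert r I) = E I"
  shows "(\<Sum>I\<in>{I. I \<subset> A}. (- 1) ^ (card A - card I + 1) * E I) = E A"
proof -
  let ?t = "\<lambda>I. (- 1) ^ (card A - card I + 1) * E I"
  have PowA: "Pow A = Pow (A - {r}) \<union> insert r ` Pow (A - {r})"
    using Pow_insert[of r "A - {r}"] r by (simp add: insert_absorb)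
  have "(\<Sum>I\<in>Pow A. ?t I) = (\<Sum>I\<in>Pow (A - {r}). ?t I) + (\<Sum>I\<in>insert r ` Pow (A - {r}). ?t I)"
    unfolding PowA using fin by (intro sum.union_disjoint) auto
  also have "(\<Sum>I\<in>insert r ` Pow (A - {r}). ?t I) = (\<Sum>I\<in>Pow (A - {r}). ?t (insert r I))"
    by (subst sum.reindex) (auto simp: inj_on_def)
  also have "\<dots> = (\<Sum>I\<in>Pow (A - {r}). - ?t I)"
  proof (rule sum.cong[OF refl])
    fix I assume "I \<in> Pow (A - {r})"
    then have I: "I \<subseteq> A - {r}" by simp
    have "card I < card A"
      using I r fin by (intro psubset_card_mono) auto
    moreover have "card (insert r I) = Suc (card I)"
      using I fin finite_subset by (subst card_insert_disjoint) auto
    ultimately have "card A - card I = Suc (card A - card (insert r I))"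
      by simp
    then show "?t (insert r I) = - ?t I"
      by (simp add: toggle[OF I])
  qed
  also have "(\<Sum>I\<in>Pow (A - {r}). ?t I) + (\<Sum>I\<in>Pow (A - {r}). - ?t I) = 0"
    by (simp add: sum_negf)
  finally have "(\<Sum>I\<in>Pow A. ?t I) = 0" .
  moreover have "Pow A = insert A {I. I \<subset> A}" by auto
  moreover have "finite {I. I \<subset> A}"
    by (rule finite_subset[of _ "Pow A"]) (use fin in auto)
  ultimately show ?thesis by simp
qed

text \<open>Evaluation at \<open>t\<close> is a ring homomorphism and commutes with the recursion.
  Over polynomials the part linear in \<open>g\<close> becomes a coefficient.\<close>

lemma poly_freeprod:
  "poly (freeprod (\<lambda>w. [:f w:]) (\<lambda>w. [:0, g w:]) u) t = freeprod f (\<lambda>w. t * g w) u"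
proof (induction u rule: length_induct)
  case (1 u)
  show ?case
  proof (cases "u = []")
    case False
    have marg: "poly (marginal (\<lambda>w. [:f w:]) (\<lambda>w. [:0, g w:]) v) t = marginal f (\<lambda>w. t * g w) v" for v
      by (simp add: marginal_def)
    have IH: "poly (freeprod (\<lambda>w. [:f w:]) (\<lambda>w. [:0, g w:]) (concat (nths (runs u) I))) t =
        freeprod f (\<lambda>w. t * g w) (concat (nths (runs u) I))" if "I \<subset> {..<length (runs u)}" for I
      using "1.IH" length_concat_nths_less[OF runs_nonempty that] by (simp add: concat_runs)
    show ?thesis
      using False
      by (subst (1 2) freeprod.simps)
        (auto simp: poly_sum poly_mult poly_prod poly_power marg IH intro!: sum.cong)
  qed (simp add: freeprod.simps)
qed

lemma ys_eq_Nil_iff: "ys u = [] \<longleftrightarrow> (\<forall>z\<in>set u. isl z)"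
  by (auto simp: ys_def filter_empty_conv)

lemma prod_marginal_monom:
  fixes f g :: "'s list \<Rightarrow> 'k::comm_ring_1"
  assumes "finite C"
  shows "(\<Prod>i\<in>C. marginal (\<lambda>w. [:f w:]) (\<lambda>w. [:0, g w:]) (v i)) =
    monom (\<Prod>i\<in>C. marginal f g (v i)) (card {i \<in> C. \<not> isl (hd (v i))})"
  using assms
proof (induction C rule: finite_induct)
  case (insert i C)
  have marg: "marginal (\<lambda>w. [:f w:]) (\<lambda>w. [:0, g w:]) (v i) =
      monom (marginal f g (v i)) (if isl (hd (v i)) then 0 else 1)"
    by (simp add: marginal_def monom_altdef)
  have "{j \<in> insert i C. \<not> isl (hd (v j))} =
      (if isl (hd (v i)) then {j \<in> C. \<not> isl (hd (v j))} else insert i {j \<in> C. \<not> isl (hd (v j))})"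
    by auto
  with insert show ?case
    by (simp add: marg mult_monom)
qed (simp add: one_pCons monom_altdef)

lemma coeff_minus_one_power_mult:
  "coeff ((- 1) ^ e * q) n = (- 1) ^ e * coeff (q :: 'k::comm_ring_1 poly) n"
  by (induction e) simp_all

lemma nths_at:
  assumes "r < length rs"
  shows "nths rs I = nths (take r rs) I @ (if r \<in> I then [rs ! r] else []) @
    nths (drop (Suc r) rs) {j. j + Suc r \<in> I}"
proof -
  have "rs = take r rs @ rs ! r # drop (Suc r) rs"
    using assms by (rule id_take_nth_drop)
  then have "nths rs I = nths (take r rs @ rs ! r # drop (Suc r) rs) I" by simp
  also have "\<dots> = nths (take r rs) I @ nths (rs ! r # drop (Suc r) rs) {j. j + r \<in> I}"
    using assms by (simp add: nths_append)
  finally show ?thesis by (simp add: nths_Cons)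
qed

lemma nths_cong_below:
  assumes "\<And>i. i < length rs \<Longrightarrow> i \<in> I \<longleftrightarrow> i \<in> I'"
  shows "nths rs I = nths rs I'"
  unfolding nths_def
proof (rule arg_cong[where f = "map fst"], rule filter_cong[OF refl])
  fix p assume "p \<in> set (zip rs [0..<length rs])"
  then have "snd p < length rs" by (auto simp: set_zip)
  then show "snd p \<in> I \<longleftrightarrow> snd p \<in> I'" by (rule assms)
qed

text \<open>
  The formal parameter of the polynomials counts occurrences of \<open>g\<close>. The defining recursion of
  \<open>freeprod\<close> says that an alternating sum over all sets \<open>I\<close> of factors vanishes; its terms of degree
  one cancel in pairs \<open>I\<close>, \<open>insert r I\<close> for a suitable factor \<open>r\<close>: the only factor in the \<open>y\<close>'s if
  there is just one, and otherwise a factor in the \<open>x\<close>'s between two factors in the \<open>y\<close>'s, which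
  fills a cyclic gap alone.
\<close>

lemma coeff_freeprod:
  fixes f g :: "'s list \<Rightarrow> 'k::comm_ring_1"
  shows "coeff (freeprod (\<lambda>w. [:f w:]) (\<lambda>w. [:0, g w:]) u) 0 =
      (if ys u = [] then (f([] := 1)) (map projl u) else 0) \<and>
    coeff (freeprod (\<lambda>w. [:f w:]) (\<lambda>w. [:0, g w:]) u) 1 = linear_part f g u"
proof (induction u rule: length_induct)
  case (1 u)
  let ?pf = "freeprod (\<lambda>w. [:f w:]) (\<lambda>w. [:0, g w:])"
  let ?M = "marginal (\<lambda>w. [:f w:]) (\<lambda>w. [:0, g w:])"
  let ?f = "f([] := 1)"
  consider "u = []" | "u \<noteq> []" "\<forall>z\<in>set u. isl z" | z where "z \<in> set u" "\<not> isl z" by blast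
  then show ?case
  proof cases
    case 1
    then show ?thesis by (simp add: freeprod.simps linear_part_def)
  next
    case 2
    then have "?pf u = [:f (map projl u):]"
      using freeprod_marginal[of u True] by (simp add: marginal_def)
    with 2 show ?thesis by (simp add: ys_x linear_part_def)
  next
    case 3
    have une: "u \<noteq> []" using 3 by auto
    have ysu: "ys u \<noteq> []" using 3 by (auto simp: ys_eq_Nil_iff)
    define rs where "rs = runs u"
    define m where "m = length rs"
    define Y where "Y = {i. i < m \<and> \<not> isl (hd (rs ! i))}"
    define cc where "cc I = concat (nths rs I)" for I
    define b where "b I = (\<Prod>i\<in>{..<m} - I. marginal f g (rs ! i))" for I
    \<comment> \<open>The degree-one coefficient of the term of \<open>I\<close>: the factors
      outside \<open>I\<close> have degree \<open>card (Y - I)\<close>, so the value at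
      \<open>cc I\<close> enters with its coefficient of degree one or zero, or not at all.\<close>
    define E where "E I = (if card (Y - I) = 0 then linear_part f g (cc I) * b I
        else if card (Y - I) = 1 then (if ys (cc I) = [] then ?f (map projl (cc I)) else 0) * b I
        else 0)" for I
    have finY: "finite Y" unfolding Y_def by simp
    have side: "rs ! i \<noteq> []" "z \<in> set (rs ! i) \<Longrightarrow> isl z \<longleftrightarrow> i \<notin> Y" if "i < m" for i z
    proof -
      have "rs ! i \<in> set (runs u)" using that by (simp add: rs_def m_def)
      note same = runs_same_side[OF this]
      from same show "rs ! i \<noteq> []" by blast
      assume "z \<in> set (rs ! i)"
      with same have "isl z = isl (hd (rs ! i))" by blast
      with that show "isl z \<longleftrightarrow> i \<notin> Y" by (simp add: Y_def)
    qed
    have alt: "i \<in> Y \<longleftrightarrow> Suc i \<notin> Y" if "Suc i < m" for i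
      using runs_alternate[of i u] that unfolding rs_def m_def Y_def by auto
    have ys_cc: "ys (cc I) = [] \<longleftrightarrow> I \<inter> Y = {}" for I
    proof
      assume ys: "ys (cc I) = []"
      have "i \<notin> Y" if i: "i \<in> I" for i
      proof
        assume "i \<in> Y"
        then have im: "i < m" by (simp add: Y_def)
        then have "set (rs ! i) \<subseteq> set (cc I)"
          using i by (auto simp: cc_def set_nths m_def)
        moreover have "hd (rs ! i) \<in> set (rs ! i)" using side(1)[OF im] by simp
        ultimately have "isl (hd (rs ! i))" using ys by (auto simp: ys_eq_Nil_iff)
        then show False using \<open>i \<in> Y\<close> by (simp add: Y_def)
      qed
      then show "I \<inter> Y = {}" by blast
    next
      assume disj: "I \<inter> Y = {}"
      show "ys (cc I) = []"
        unfolding ys_eq_Nil_iff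
      proof
        fix z assume "z \<in> set (cc I)"
        then obtain i where "i < m" "i \<in> I" "z \<in> set (rs ! i)"
          by (auto simp: cc_def set_nths m_def)
        then show "isl z" using side(2) disj by blast
      qed
    qed
    have cc_all: "cc {..<m} = u"
      by (simp add: cc_def m_def nths_all rs_def concat_runs)
    have Yne: "Y \<noteq> {}"
      using ysu ys_cc[of "{..<m}"] unfolding cc_all by auto
    have YI: "{i \<in> {..<m} - I. \<not> isl (hd (rs ! i))} = Y - I" for I
      by (auto simp: Y_def)
    have M: "(\<Prod>i\<in>{..<m} - I. ?M (rs ! i)) = monom (b I) (card (Y - I))" for I
      unfolding prod_marginal_monom[OF finite_Diff[OF finite_lessThan]] YI b_def ..
    have IH: "coeff (?pf (cc I)) 0 = (if ys (cc I) = [] then ?f (map projl (cc I)) else 0)"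
      "coeff (?pf (cc I)) 1 = linear_part f g (cc I)" if "I \<subset> {..<m}" for I
      using "1.IH"[rule_format, of "cc I"] length_concat_nths_less[OF runs_nonempty, of I u] that
      by (auto simp: concat_runs cc_def rs_def m_def)
    define T where "T I = ?pf (cc I) * (\<Prod>i\<in>{..<m} - I. ?M (rs ! i))" for I
    have rec: "?pf u = (\<Sum>I\<in>{I. I \<subset> {..<m}}. (- 1) ^ (m - card I + 1) * T I)"
      using une by (subst freeprod.simps) (simp add: T_def rs_def m_def cc_def mult.assoc)
    have T0: "coeff (T I) 0 = 0" if I: "I \<subset> {..<m}" for I
    proof (cases "Y - I = {}")
      case True
      then have "ys (cc I) \<noteq> []" using ys_cc Yne by blast
      then show ?thesis unfolding T_def M by (simp add: IH[OF I] coeff_mult_0)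
    next
      case False
      then have "card (Y - I) > 0" using finY by (simp add: card_gt_0_iff)
      then show ?thesis unfolding T_def M by (simp add: coeff_mult_0)
    qed
    have T1: "coeff (T I) 1 = E I" if I: "I \<subset> {..<m}" for I
    proof -
      have "coeff (T I) 1 = coeff (monom (b I) (card (Y - I)) * ?pf (cc I)) 1"
        unfolding T_def M by (simp add: mult.commute)
      also have "\<dots> = (if 1 < card (Y - I) then 0 else b I * coeff (?pf (cc I)) (1 - card (Y - I)))"
        by (simp add: coeff_monom_mult)
      also have "\<dots> = E I"
      proof -
        consider "card (Y - I) = 0" | "card (Y - I) = 1" | "card (Y - I) > 1" by linarith
        then show ?thesis
          by cases (simp_all add: E_def IH[OF I, simplified] mult.commute)
      qed
      finally show ?thesis .
    qed
    have c0: "coeff (?pf u) 0 = 0"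
      unfolding rec coeff_sum coeff_minus_one_power_mult by (simp add: T0)
    have "\<exists>r<m. \<forall>I. I \<subseteq> {..<m} - {r} \<longrightarrow> E (insert r I) = E I"
    proof (cases "card Y = 1")
      case True
      then obtain r where Yr: "Y = {r}" by (auto simp: card_1_singleton_iff)
      then have r: "r < m" by (auto simp: Y_def)
      have "E (insert r I) = E I" if I: "I \<subseteq> {..<m} - {r}" for I
      proof -
        let ?p = "concat (nths (take r rs) I)"
        let ?q = "concat (nths (drop (Suc r) rs) {j. j + Suc r \<in> I})"
        have rI: "r \<notin> I" using I by blast
        have ccI: "cc I = ?p @ ?q"
          using nths_at[of r rs I] r rI by (simp add: cc_def m_def)
        have ccr: "cc (insert r I) = ?p @ rs ! r @ ?q"
        proof -
          have "nths (take r rs) (insert r I) = nths (take r rs) I"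
            by (rule nths_cong_below) auto
          moreover have "{j. j + Suc r \<in> insert r I} = {j. j + Suc r \<in> I}" by auto
          ultimately show ?thesis
            using nths_at[of r rs "insert r I"] r by (simp add: cc_def m_def)
        qed
        have ysI: "ys (cc I) = []" using ys_cc Yr rI by blast
        then have px: "\<forall>z\<in>set ?p. isl z" "\<forall>z\<in>set ?q. isl z"
          unfolding ccI ys_eq_Nil_iff by auto
        have yr: "rs ! r \<noteq> []" "\<forall>z\<in>set (rs ! r). \<not> isl z"
          using side[OF r] Yr by auto
        have "b I = marginal f g (rs ! r) * b (insert r I)"
          unfolding b_def Diff_insert[of _ r I] using r rI by (intro prod.remove) auto
        moreover have "marginal f g (rs ! r) = g (map projr (rs ! r))"
          using yr by (simp add: marginal_def)
        moreover have "linear_part f g (cc (insert r I)) = g (map projr (rs ! r)) * ?f (map projl (cc I))"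
          unfolding ccr ccI by (rule linear_part_single_y_run[OF yr px])
        moreover have "Y - I = {r}" "Y - insert r I = {}" using Yr rI by auto
        ultimately show ?thesis
          unfolding E_def by (simp add: ysI mult_ac)
      qed
      with r show ?thesis by blast
    next
      case False
      then have Y2: "card Y \<ge> 2" using Yne finY by (metis One_nat_def card_0_eq less_2_cases_iff not_le)
      define y0 where "y0 = Min Y"
      have y0: "y0 \<in> Y" and y0_min: "\<And>y. y \<in> Y \<Longrightarrow> y0 \<le> y"
        unfolding y0_def using finY Yne by auto
      have "\<not> Y \<subseteq> {y0}"
        using Y2 card_mono[of "{y0}" Y] by auto
      then obtain y1 where y1: "y1 \<in> Y" "y1 \<noteq> y0" by blast
      then have "y0 < y1" "y1 < m" using y0_min[OF y1(1)] by (auto simp: Y_def)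
      \<comment> \<open>The run after the first y-run consists of x's, and since \<open>y1\<close>
        lies further on, another y-run follows it.\<close>
      define r where "r = Suc y0"
      have rm: "r < m" unfolding r_def using \<open>y0 < y1\<close> \<open>y1 < m\<close> by simp
      have rY: "r \<notin> Y" using alt[of y0] y0 rm unfolding r_def by simp
      then have "r \<noteq> y1" using y1 by blast
      then have rm2: "Suc r < m" using \<open>y0 < y1\<close> \<open>y1 < m\<close> unfolding r_def by simp
      have rY2: "Suc r \<in> Y" using alt[of r] rY rm2 by simp
      have "E (insert r I) = E I" if I: "I \<subseteq> {..<m} - {r}" for I
      proof -
        have rI: "r \<notin> I" using I by blast
        have YI': "Y - insert r I = Y - I" using rY by blast
        have ysr: "ys (cc (insert r I)) = [] \<longleftrightarrow> ys (cc I) = []"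
          unfolding ys_cc using rY by blast
        consider "Y - I = {}" | "card (Y - I) = 1" | "card (Y - I) \<noteq> 0" "card (Y - I) \<noteq> 1"
          using card_0_eq[OF finite_Diff[OF finY, of I]] by blast
        then show ?thesis
        proof cases
          case 1
          then have card_YI: "card (Y - I) = 0" by (simp only: card.empty)
          \<comment> \<open>\<open>I\<close> contains all y-runs, in particular both neighbours of
            \<open>r\<close>, so inserting \<open>r\<close> places its x's directly between two
            y's.\<close>
          from 1 have mem: "y0 \<in> I" "Suc r \<in> I" using y0 rY2 by auto
          let ?p = "concat (nths (take r rs) I)"
          let ?q = "concat (nths (drop (Suc r) rs) {j. j + Suc r \<in> I})"
          have ccI: "cc I = ?p @ ?q"
            using nths_at[of r rs I] rm rI by (simp add: cc_def m_def)
          have ccr: "cc (insert r I) = ?p @ rs ! r @ ?q"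
          proof -
            have "nths (take r rs) (insert r I) = nths (take r rs) I"
              by (rule nths_cong_below) auto
            moreover have "{j. j + Suc r \<in> insert r I} = {j. j + Suc r \<in> I}" by auto
            ultimately show ?thesis
              using nths_at[of r rs "insert r I"] rm by (simp add: cc_def m_def)
          qed
          have xr: "rs ! r \<noteq> []" "\<forall>z\<in>set (rs ! r). isl z"
            using side[OF rm] rY by auto
          have y0r: "rs ! y0 \<noteq> []" "\<forall>z\<in>set (rs ! y0). \<not> isl z"
            using side[of y0] y0 rm by (auto simp: r_def)
          have ry2: "rs ! Suc r \<noteq> []" "\<forall>z\<in>set (rs ! Suc r). \<not> isl z"
            using side[OF rm2] rY2 by auto
          have "take r rs = take y0 rs @ [rs ! y0]"
            using rm by (simp add: r_def m_def take_Suc_conv_app_nth)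
          then have "?p = concat (nths (take y0 rs) I) @ rs ! y0"
            using mem rm by (simp add: nths_append r_def m_def)
          then have p: "?p \<noteq> []" "\<not> isl (last ?p)"
            using y0r by auto
          have "drop (Suc r) rs = rs ! Suc r # drop (Suc (Suc r)) rs"
            using rm2 by (simp add: m_def Cons_nth_drop_Suc)
          then have "?q = rs ! Suc r @ concat (nths (drop (Suc (Suc r)) rs) {j. Suc j \<in> {j. j + Suc r \<in> I}})"
            using mem by (simp add: nths_Cons)
          then have q: "?q \<noteq> []" "\<not> isl (hd ?q)"
            using ry2 by auto
          have "linear_part f g (cc (insert r I)) = f (map projl (rs ! r)) * linear_part f g (cc I)"
            unfolding ccI ccr by (rule linear_part_remove_x_run[OF xr p q])
          moreover have "b I = marginal f g (rs ! r) * b (insert r I)"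
            unfolding b_def Diff_insert[of _ r I] using rm rI by (intro prod.remove) auto
          moreover have "marginal f g (rs ! r) = f (map projl (rs ! r))"
            using xr by (simp add: marginal_def)
          ultimately show ?thesis
            unfolding E_def YI' card_YI by (simp add: mult_ac)
        next
          case 2
          \<comment> \<open>Of at least two y-runs only one is outside \<open>I\<close>; a y thus
            remains in \<open>cc I\<close>, and the coefficient of degree zero vanishes
            there.\<close>
          have "I \<inter> Y \<noteq> {}"
          proof
            assume "I \<inter> Y = {}"
            then have "Y - I = Y" by blast
            with 2 Y2 show False by simp
          qed
          then have "ys (cc I) \<noteq> []" using ys_cc by blast
          then show ?thesis
            unfolding E_def YI' using 2 ysr by simp
        next
          case 3
          then show ?thesis unfolding E_def YI' by simp
        qed
      qed
      with rm show ?thesis by blast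
    qed
    then obtain r where r: "r < m" "\<And>I. I \<subseteq> {..<m} - {r} \<Longrightarrow> E (insert r I) = E I" by blast
    have "coeff (?pf u) 1 = (\<Sum>I\<in>{I. I \<subset> {..<m}}. (- 1) ^ (card {..<m} - card I + 1) * E I)"
      unfolding rec coeff_sum coeff_minus_one_power_mult using T1 by (intro sum.cong) auto
    also have "\<dots> = E {..<m}"
      using r by (intro alternating_sum_toggle[of _ r]) auto
    also have "\<dots> = linear_part f g u"
    proof -
      have "Y - {..<m} = {}" by (auto simp: Y_def)
      then have "card (Y - {..<m}) = 0" by (simp only: card.empty)
      then show ?thesis unfolding E_def cc_all b_def by (simp only: if_True refl Diff_cancel prod.empty mult_1_right)
    qed
    finally show ?thesis using c0 ysu by simp
  qed
qed

section \<open>Expansion of \<open>Delta_a\<close> into words with marked positions\<close>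

fun mark :: "nat set \<Rightarrow> 's list \<Rightarrow> ('s + 's) list" where
  "mark V [] = []"
| "mark V (x # w) = (if 0 \<in> V then Inr x else Inl x) # mark {j. Suc j \<in> V} w"

lemma mark_snoc: "mark V (w @ [x]) = mark V w @ [if length w \<in> V then Inr x else Inl x]"
  by (induction w arbitrary: V) auto

lemma ys_mark: "ys (mark V w) = nths w V"
  by (induction w arbitrary: V) (auto simp: nths_Cons)

text \<open>The bridge between gaps of a monomial and gaps of a set of positions: the letter at a
  position \<open>i\<close> outside \<open>V\<close> is preceded by
  \<open>card {v \<in> V. v \<le> i}\<close> letters y. Appending on the right leaves these counts
  unchanged.\<close>

lemma gapword_mark:
  "gapword k c (mark V w) = nths w {i. i \<notin> V \<and> card {v \<in> V. v \<le> i} mod k = c}"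
proof (induction w rule: rev_induct)
  case (snoc x w)
  let ?n = "length w"
  have "length (ys (mark V w)) = card {v \<in> V. v < ?n}"
    by (auto simp: ys_mark length_nths intro!: arg_cong[where f = card])
  moreover have "{v \<in> V. v < ?n} = {v \<in> V. v \<le> ?n}" if "?n \<notin> V"
    using that by (auto simp: le_less)
  ultimately show ?case
    using snoc by (auto simp: gapword_def mark_snoc gap_index_append nths_append)
qed (simp add: gapword_def)

lemma Pow_lessThan_Suc:
  "Pow {..<Suc n} = (`) Suc ` Pow {..<n} \<union> (\<lambda>V. insert 0 (Suc ` V)) ` Pow {..<n}"
proof -
  have "{..<Suc n} = insert 0 (Suc ` {..<n})" by (rule lessThan_Suc_eq_insert_0)
  then show ?thesis
    by (simp add: Pow_insert image_Pow_surj[of Suc "{..<n}", OF refl, symmetric] image_image)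
qed

text \<open>Multiplying out gives one monomial for every set \<open>V\<close> of positions at which
  the summand y is chosen.\<close>

lemma functional_Delta_a:
  fixes \<phi> :: "('s + 's) list \<Rightarrow> 'k::comm_ring_1" and w :: "'s list"
  shows "functional \<phi> (Delta_a w) = (\<Sum>V\<in>Pow {..<length w}. \<phi> (mark V w))"
proof (induction w arbitrary: \<phi>)
  case Nil
  have "(Delta_a [] :: ('s + 's, 'k) ncpoly) = Poly_Mapping.single [] 1"
    unfolding Delta_a_def by (metis list.simps(8) prod_list.Nil single_one zero_list_def)
  then show ?case by simp
next
  case (Cons x w)
  let ?P = "Pow {..<length w}"
  have "Delta_a (x # w) = (ncvar (Inl x) + ncvar (Inr x)) * (Delta_a w :: ('s + 's, 'k) ncpoly)"
    by (simp add: Delta_a_def)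
  then have "functional \<phi> (Delta_a (x # w)) =
      functional (\<lambda>v. \<phi> ([Inl x] @ v)) (Delta_a w) + functional (\<lambda>v. \<phi> ([Inr x] @ v)) (Delta_a w)"
    by (simp only: distrib_right functional_add ncvar_def functional_single_mult mult_1_left)
  also have "\<dots> = (\<Sum>V\<in>?P. \<phi> (Inl x # mark V w)) + (\<Sum>V\<in>?P. \<phi> (Inr x # mark V w))"
    by (simp add: Cons.IH)
  also have "\<dots> = (\<Sum>V\<in>(`) Suc ` ?P. \<phi> (mark V (x # w))) +
      (\<Sum>V\<in>(\<lambda>V. insert 0 (Suc ` V)) ` ?P. \<phi> (mark V (x # w)))"
  proof -
    have "inj_on ((`) Suc) ?P" by (auto intro!: inj_onI)
    moreover have "inj_on (\<lambda>V. insert 0 (Suc ` V)) ?P"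
      by (rule inj_onI) (metis image_iff inj_Suc inj_image_eq_iff insert_ident nat.distinct(1))
    moreover have "{j. Suc j \<in> Suc ` V} = V" "{j. Suc j \<in> insert 0 (Suc ` V)} = V" for V by auto
    ultimately show ?thesis by (simp add: sum.reindex)
  qed
  also have "\<dots> = (\<Sum>V\<in>Pow {..<Suc (length w)}. \<phi> (mark V (x # w)))"
    unfolding Pow_lessThan_Suc by (rule sum.union_disjoint[symmetric]) auto
  finally show ?case by simp
qed

lemma boxplus_mark:
  "w \<noteq> [] \<Longrightarrow> (f \<boxplus> g) w = (\<Sum>V\<in>Pow {..<length w}. freeprod f g (mark V w))"
  by (simp add: boxplus_def functional_Delta_a)

section \<open>The exponential curve\<close>

text \<open>For a position outside \<open>V\<close>, the point just right of it lies in the same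
  cyclic gap as the position itself, so \<open>key\<close> numbers positions too.\<close>

definition gap :: "nat \<Rightarrow> nat set \<Rightarrow> nat \<Rightarrow> nat set" where
  "gap n V c = {i. i < n \<and> i \<notin> V \<and> key V i = c}"

text \<open>A crossing would, by \<open>unsplit_crossing\<close>, give equal keys to points of
  different gaps.\<close>

lemma uncrossed_gap:
  assumes "finite V" "V \<noteq> {}" "c \<noteq> d"
  shows "uncrossed (gap n V c) (gap n V d)"
  unfolding uncrossed_def
proof (rule notI, clarify)
  fix i j i' j' assume *: "i \<in> gap n V c" "j \<in> gap n V d" "i' \<in> gap n V c" "j' \<in> gap n V d"
    "i < j" "j < i'" "i' < j'"
  then have "unsplit V {i<..i'}" "unsplit V {j<..j'}"
    using key_eq_iff[OF assms(1,2), of i i'] key_eq_iff[OF assms(1,2), of j j'] by (auto simp: gap_def)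
  then have "unsplit V {i<..j}" using unsplit_crossing * by blast
  then have "key V i = key V j"
    using key_eq_iff[OF assms(1,2), of i j] * by auto
  then show False using * assms(3) by (simp add: gap_def)
qed

lemma uncrossed_gap_block:
  assumes "finite V" "V \<noteq> {}"
  shows "uncrossed V (gap n V c)" "uncrossed (gap n V c) V"
proof -
  have *: "unsplit V {i<..j}" if "i \<in> gap n V c" "j \<in> gap n V c" "i < j" for i j
    using key_eq_iff[OF assms, of i j] that by (auto simp: gap_def)
  show "uncrossed V (gap n V c)"
    unfolding uncrossed_def
  proof (rule notI, clarify)
    fix v i v' j assume a: "v \<in> V" "i \<in> gap n V c" "v' \<in> V" "j \<in> gap n V c" "v < i" "i < v'" "v' < j"
    then have "unsplit V {i<..j}" using * by auto
    then show False using unsplitD[of V "{i<..j}" v' v] a by auto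
  qed
  show "uncrossed (gap n V c) V"
    unfolding uncrossed_def
  proof (rule notI, clarify)
    fix i v j v' assume a: "i \<in> gap n V c" "v \<in> V" "j \<in> gap n V c" "v' \<in> V" "i < v" "v < j" "j < v'"
    then have "unsplit V {i<..j}" using * by auto
    then show False using unsplitD[of V "{i<..j}" v v'] a by auto
  qed
qed

lemma Union_gap:
  assumes "finite V" "V \<noteq> {}"
  shows "(\<Union>c\<in>{..<card V}. gap n V c) = {..<n} - V"
proof -
  have "key V i < card V" for i
    unfolding key_def using assms by (simp add: card_gt_0_iff)
  then show ?thesis by (auto simp: gap_def)
qed

text \<open>If \<open>V\<close> separated two elements of \<open>U\<close>, elements of
  \<open>V\<close> on both sides would cross \<open>U\<close>; hence the key is constant on
  \<open>U\<close>.\<close>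

lemma nc_block_in_gap:
  assumes P: "P \<in> nc_on {..<n}" and V: "V \<in> P" and U: "U \<in> P" "U \<noteq> V"
  shows "\<exists>c\<in>{..<card V}. U \<subseteq> gap n V c"
proof -
  note Vf = nc_on_block_finite[OF P V]
  have disj: "U \<inter> V = {}" by (rule nc_onD(4)[OF P U(1) V U(2)])
  have unc: "uncrossed U V" "uncrossed V U"
    using nc_onD(5)[OF P U(1) V U(2)] nc_onD(5)[OF P V U(1)] U(2) by auto
  have uns: "unsplit V {i<..j}" if ij: "i \<in> U" "j \<in> U" "i < j" for i j
  proof (rule ccontr)
    assume "\<not> unsplit V {i<..j}"
    then obtain x y where xy: "x \<in> V" "i < x" "x \<le> j" "y \<in> V" "y \<le> i \<or> j < y"
      by (auto elim!: not_unsplitE)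
    have ne: "x \<noteq> j" "y \<noteq> i" using xy ij disj by blast+
    then have "x < j" using xy by simp
    from xy(5) show False
    proof
      assume "y \<le> i"
      then have "y < i" using ne by simp
      then show False using unc(2) xy ij \<open>x < j\<close> unfolding uncrossed_def by blast
    next
      assume "j < y"
      then show False using unc(1) xy ij \<open>x < j\<close> unfolding uncrossed_def by blast
    qed
  qed
  have key: "key V i = key V j" if "i \<in> U" "j \<in> U" for i j
    using that
  proof (induction i j rule: linorder_wlog)
    case (le i j)
    then show ?case
      using key_eq_iff[OF Vf, of i j] uns[of i j] by (cases "i = j") auto
  next
    case (sym i j)
    then show ?case by simp
  qed
  obtain i where i: "i \<in> U" using nc_onD(2)[OF P] U(1) by (metis all_not_in_conv)
  have "U \<subseteq> gap n V (key V i)"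
    using key[OF _ i] disj nc_onD(3)[OF P U(1)] unfolding gap_def by blast
  moreover have "key V i < card V"
    unfolding key_def using Vf by (simp add: card_gt_0_iff)
  ultimately show ?thesis by blast
qed

text \<open>Once \<open>V\<close> is fixed, the other blocks form independent non-crossing
  partitions of its gaps, since the gaps cross neither each other nor \<open>V\<close>.\<close>

lemma nc_sum_block:
  assumes V: "V \<subseteq> {..<n}" "V \<noteq> {}"
  shows "(\<Sum>P\<in>{P \<in> nc_on {..<n}. V \<in> P}. \<Prod>U\<in>P. h U) =
    h V * (\<Prod>c<card V. nc_sum h (gap n V c))"
proof -
  have fin: "finite V" using V finite_subset by blast
  let ?h1 = "\<lambda>U. if \<exists>c\<in>{..<card V}. U \<subseteq> gap n V c then h U else 0"
  let ?h2 = "\<lambda>U. if U = V then h U else 0"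
  let ?H = "\<lambda>U. if U \<subseteq> V then ?h2 U else if U \<subseteq> {..<n} - V then ?h1 U else 0"
  have "(\<Prod>c<card V. nc_sum h (gap n V c)) = nc_sum ?h1 ({..<n} - V)"
    unfolding Union_gap[OF fin V(2), of n, symmetric]
  proof (rule prod_nc_sum)
    fix c d :: nat assume "c \<noteq> d"
    then show "gap n V c \<inter> gap n V d = {} \<and> uncrossed (gap n V c) (gap n V d)"
      using uncrossed_gap[OF fin V(2)] by (auto simp: gap_def)
  qed (auto simp: gap_def)
  then have "h V * (\<Prod>c<card V. nc_sum h (gap n V c)) = nc_sum ?h2 V * nc_sum ?h1 ({..<n} - V)"
    by (simp add: nc_sum_singleton_block[OF V(2) fin])
  also have "\<dots> = nc_sum ?H (V \<union> ({..<n} - V))"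
  proof (rule nc_sum_Un)
    fix U W assume "?h2 U \<noteq> 0" "?h1 W \<noteq> 0"
    then obtain c where "U = V" "W \<subseteq> gap n V c" by (metis (full_types))
    then show "uncrossed U W \<and> uncrossed W U"
      using uncrossed_gap_block[OF fin V(2)] by (meson order_refl uncrossed_mono)
  qed (use fin in auto)
  also have "V \<union> ({..<n} - V) = {..<n}" using V by auto
  also have "nc_sum ?H {..<n} = (\<Sum>P\<in>nc_on {..<n}. if V \<in> P then \<Prod>U\<in>P. h U else 0)"
    unfolding nc_sum_def
  proof (rule sum.cong[OF refl])
    fix P assume P: "P \<in> nc_on {..<n}"
    show "(\<Prod>U\<in>P. ?H U) = (if V \<in> P then \<Prod>U\<in>P. h U else 0)"
    proof (cases "V \<in> P")
      case True
      have "?H U = h U" if U: "U \<in> P" for U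
      proof (cases "U = V")
        case False
        obtain c where c: "c \<in> {..<card V}" "U \<subseteq> gap n V c"
          using nc_block_in_gap[OF P True U False] by blast
        have sub: "U \<subseteq> {..<n} - V" using c(2) by (auto simp: gap_def)
        moreover have "U \<noteq> {}" using nc_onD(2)[OF P] U by auto
        ultimately have "\<not> U \<subseteq> V" by blast
        moreover have "?h1 U = h U" using c by metis
        ultimately show ?thesis using sub by simp
      qed simp
      then show ?thesis using True by simp
    next
      case False
      obtain v where v: "v \<in> V" using V by blast
      then have "v \<in> \<Union>P" using nc_onD(1)[OF P] V by auto
      then obtain U where U: "U \<in> P" "v \<in> U" by blast
      \<comment> \<open>\<open>U\<close> meets \<open>V\<close> without being equal to it: it is a
        proper subset of \<open>V\<close> or sticks out of it, and both have weight 0.\<close>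
      then have "?H U = 0" using v False by auto
      then have "(\<Prod>U\<in>P. ?H U) = 0"
        using U(1) finite_nc_on_elem[OF finite_lessThan P] by (intro prod_zero bexI)
      then show ?thesis using False by simp
    qed
  qed
  also have "\<dots> = (\<Sum>P\<in>{P \<in> nc_on {..<n}. V \<in> P}. \<Prod>U\<in>P. h U)"
    by (simp add: sum.inter_filter[symmetric] finite_nc_on)
  finally show ?thesis ..
qed

text \<open>The coordinate at the empty word is reset to 0 so that the curve stays in
  \<open>ncseries\<close>.\<close>

definition mom_curve :: "('s list \<Rightarrow> 'k::field_char_0) \<Rightarrow> 's list \<Rightarrow> 'k poly" where
  "mom_curve \<xi> w = (if w = [] then 0 else mom (\<lambda>v. [:0, \<xi> v:]) w)"

lemma poly_mom: "poly (mom \<Xi> w) t = mom (\<lambda>v. poly (\<Xi> v) t) w"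
  by (simp add: mom_def nc_sum_def poly_sum poly_prod)

lemma curve_at_mom_curve:
  "(curve_at (mom_curve \<xi>) t)([] := 1) = mom (\<lambda>v. t * \<xi> v)"
  by (rule ext) (simp add: curve_at_def mom_curve_def poly_mom)

lemma pderiv_sum: "pderiv (\<Sum>i\<in>A. p i) = (\<Sum>i\<in>A. pderiv (p i))"
  by (induction A rule: infinite_finite_induct) (simp_all add: pderiv_add)

text \<open>The product rule singles out one block \<open>V\<close>; exchanging the sums collects
  the partitions that contain \<open>V\<close>, and \<open>nc_sum_block\<close> factors each
  collection over the gaps.\<close>

lemma poly_pderiv_mom_curve:
  assumes "w \<noteq> []"
  shows "poly (pderiv (mom_curve \<xi> w)) t =
    (\<Sum>V\<in>Pow {..<length w} - {{}}. \<xi> (nths w V) *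
       (\<Prod>c<card V. mom (\<lambda>v. t * \<xi> v) (nths w (gap (length w) V c))))"
proof -
  let ?n = "length w"
  let ?N = "nc_on {..<?n}" and ?S = "Pow {..<?n} - {{}}"
  let ?F = "\<lambda>P V. (\<Prod>U\<in>P - {V}. t * \<xi> (nths w U)) * \<xi> (nths w V)"
  have "poly (pderiv (mom_curve \<xi> w)) t = (\<Sum>P\<in>?N. \<Sum>V\<in>P. ?F P V)"
    using assms by (simp add: mom_curve_def mom_def nc_sum_def pderiv_sum
        pderiv_prod pderiv_pCons poly_sum poly_prod poly_mult mult.commute)
  also have "\<dots> = (\<Sum>P\<in>?N. \<Sum>V\<in>{V \<in> ?S. V \<in> P}. ?F P V)"
  proof (rule sum.cong[OF refl])
    fix P assume P: "P \<in> ?N"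
    have "{V \<in> ?S. V \<in> P} = P" using nc_onD(2,3)[OF P] by blast
    then show "(\<Sum>V\<in>P. ?F P V) = (\<Sum>V\<in>{V \<in> ?S. V \<in> P}. ?F P V)" by simp
  qed
  also have "\<dots> = (\<Sum>V\<in>?S. \<Sum>P\<in>{P \<in> ?N. V \<in> P}. ?F P V)"
    by (rule sum.swap_restrict) (simp_all add: finite_nc_on)
  also have "\<dots> = (\<Sum>V\<in>?S. \<xi> (nths w V) *
       (\<Prod>c<card V. mom (\<lambda>v. t * \<xi> v) (nths w (gap ?n V c))))"
  proof (rule sum.cong[OF refl])
    fix V assume "V \<in> ?S"
    then have V: "V \<subseteq> {..<?n}" "V \<noteq> {}" by auto
    \<comment> \<open>The differentiated block has lost its factor \<open>t\<close>; a block inside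
      a gap differs from \<open>V\<close> and keeps it.\<close>
    let ?h = "\<lambda>U. if U = V then \<xi> (nths w V) else t * \<xi> (nths w U)"
    have "(\<Sum>P\<in>{P \<in> ?N. V \<in> P}. ?F P V) = (\<Sum>P\<in>{P \<in> ?N. V \<in> P}. \<Prod>U\<in>P. ?h U)"
    proof (rule sum.cong[OF refl])
      fix P assume "P \<in> {P \<in> ?N. V \<in> P}"
      then have "finite P" "V \<in> P" using finite_nc_on_elem by auto
      then have "(\<Prod>U\<in>P. ?h U) = ?h V * (\<Prod>U\<in>P - {V}. ?h U)" by (rule prod.remove)
      also have "(\<Prod>U\<in>P - {V}. ?h U) = (\<Prod>U\<in>P - {V}. t * \<xi> (nths w U))"
        by (rule prod.cong) auto
      finally show "?F P V = (\<Prod>U\<in>P. ?h U)" by (simp add: mult.commute)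
    qed
    also have "\<dots> = ?h V * (\<Prod>c<card V. nc_sum ?h (gap ?n V c))"
      by (rule nc_sum_block[OF V])
    also have "(\<Prod>c<card V. nc_sum ?h (gap ?n V c)) =
        (\<Prod>c<card V. mom (\<lambda>v. t * \<xi> v) (nths w (gap ?n V c)))"
    proof (rule prod.cong[OF refl])
      fix c
      have "nc_sum ?h (gap ?n V c) = nc_sum (\<lambda>U. t * \<xi> (nths w U)) (gap ?n V c)"
      proof (rule nc_sum_cong)
        fix U assume "U \<subseteq> gap ?n V c" "U \<noteq> {}"
        then have "U \<noteq> V" by (auto simp: gap_def)
        then show "?h U = t * \<xi> (nths w U)" by simp
      qed
      also have "\<dots> = mom (\<lambda>v. t * \<xi> v) (nths w (gap ?n V c))"
        by (rule nc_sum_nths) (auto simp: gap_def)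
      finally show "nc_sum ?h (gap ?n V c) = mom (\<lambda>v. t * \<xi> v) (nths w (gap ?n V c))" .
    qed
    finally show "(\<Sum>P\<in>{P \<in> ?N. V \<in> P}. ?F P V) = \<xi> (nths w V) *
       (\<Prod>c<card V. mom (\<lambda>v. t * \<xi> v) (nths w (gap ?n V c)))" by simp
  qed
  finally show ?thesis .
qed

section \<open>The Jacobian of a translation at 0\<close>

lemma partial_deriv_eq_coeff:
  assumes "\<And>t. poly p t = F (a(v := t))" "a v = 0"
  shows "partial_deriv F a v = coeff p 1"
proof -
  \<comment> \<open>A field of characteristic 0 is infinite, so the values determine the
    polynomial.\<close>
  have "(THE q. \<forall>t. poly q t = F (a(v := t))) = p"
    using assms(1) by (intro the_equality) (auto simp flip: poly_eq_poly_eq_iff)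
  then show ?thesis
    using assms(2) by (simp add: partial_deriv_def poly_0_coeff_0 coeff_pderiv)
qed

text \<open>Along the coordinate \<open>v\<close> the second argument is \<open>t\<close> times the
  indicator of \<open>v\<close>, so the derivative is the linear part at this indicator. The empty
  \<open>V\<close> drops out because it marks no y.\<close>

lemma jacobian_boxplus:
  fixes f :: "'s list \<Rightarrow> 'k::field_char_0"
  assumes "w \<noteq> []"
  shows "jacobian ((\<boxplus>) f) zero_series w v =
    (\<Sum>V\<in>Pow {..<length w} - {{}}. (if nths w V = v then 1 else 0) *
       (\<Prod>c<card V. (f([] := 1)) (nths w (gap (length w) V c))))"
proof -
  let ?g = "\<lambda>u. if u = v then 1 else 0 :: 'k"
  let ?n = "length w"
  let ?p = "\<Sum>V\<in>Pow {..<?n}. freeprod (\<lambda>u. [:f u:]) (\<lambda>u. [:0, ?g u:]) (mark V w)"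
  have "jacobian ((\<boxplus>) f) zero_series w v = coeff ?p 1"
    unfolding jacobian_def
  proof (rule partial_deriv_eq_coeff)
    fix t
    have "zero_series(v := t) = (\<lambda>u. t * ?g u)" by (auto simp: zero_series_def)
    then show "poly ?p t = (f \<boxplus> zero_series(v := t)) w"
      by (simp add: boxplus_mark[OF assms] poly_sum poly_freeprod)
  qed (simp add: zero_series_def)
  also have "\<dots> = (\<Sum>V\<in>Pow {..<?n}. linear_part f ?g (mark V w))"
    by (simp only: coeff_sum coeff_freeprod)
  also have "\<dots> = (\<Sum>V\<in>Pow {..<?n} - {{}}. linear_part f ?g (mark V w))"
    by (rule sum.mono_neutral_right) (auto simp: linear_part_def ys_mark)
  also have "\<dots> = (\<Sum>V\<in>Pow {..<?n} - {{}}. ?g (nths w V) *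
       (\<Prod>c<card V. (f([] := 1)) (nths w (gap ?n V c))))"
  proof (rule sum.cong[OF refl])
    fix V assume "V \<in> Pow {..<?n} - {{}}"
    then have V: "V \<subseteq> {..<?n}" "V \<noteq> {}" by auto
    have "gapword (card V) c (mark V w) = nths w (gap ?n V c)" for c
      unfolding gapword_mark gap_def key_def by (rule nths_cong_below) auto
    then show "linear_part f ?g (mark V w) = ?g (nths w V) *
       (\<Prod>c<card V. (f([] := 1)) (nths w (gap ?n V c)))"
      using nths_nonempty[OF V] by (simp add: linear_part_def ys_mark length_nths_subset[OF V(1)])
  qed
  finally show ?thesis .
qed

lemma jacobian_boxplus_Nil: "jacobian ((\<boxplus>) f) zero_series [] v = 0"
  unfolding jacobian_def
  by (subst partial_deriv_eq_coeff[where p = 0]) (simp_all add: boxplus_def zero_series_def)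

lemma mat_apply_superset:
  assumes "finite B" "\<And>v. M w v \<noteq> 0 \<Longrightarrow> v \<in> B"
  shows "mat_apply M \<xi> w = (\<Sum>v\<in>B. M w v * \<xi> v)"
  unfolding mat_apply_def using assms by (intro sum.mono_neutral_left) auto

text \<open>Non-zero columns belong to words spelled by sets of positions, so each row is finite;
  several sets may spell the same word, and summing over the columns sorts them out.\<close>

lemma mat_apply_jacobian_boxplus:
  assumes "w \<noteq> []"
  shows "mat_apply (jacobian ((\<boxplus>) f) zero_series) \<xi> w =
    (\<Sum>V\<in>Pow {..<length w} - {{}}. \<xi> (nths w V) *
       (\<Prod>c<card V. (f([] := 1)) (nths w (gap (length w) V c))))"
proof -
  let ?S = "Pow {..<length w} - {{}}"
  let ?D = "\<lambda>V. \<Prod>c<card V. (f([] := 1)) (nths w (gap (length w) V c))"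
  have "mat_apply (jacobian ((\<boxplus>) f) zero_series) \<xi> w =
      (\<Sum>v\<in>nths w ` ?S. jacobian ((\<boxplus>) f) zero_series w v * \<xi> v)"
  proof (rule mat_apply_superset)
    fix v assume "jacobian ((\<boxplus>) f) zero_series w v \<noteq> 0"
    then obtain V where "V \<in> ?S" "(if nths w V = v then 1 else 0) * ?D V \<noteq> 0"
      unfolding jacobian_boxplus[OF assms] by (meson sum.not_neutral_contains_not_neutral)
    then show "v \<in> nths w ` ?S" by (auto split: if_splits)
  qed simp
  also have "\<dots> = (\<Sum>V\<in>?S. \<Sum>v\<in>nths w ` ?S. (if nths w V = v then \<xi> v * ?D V else 0))"
    unfolding jacobian_boxplus[OF assms] sum_distrib_right
    by (subst sum.swap) (intro sum.cong refl, simp)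
  also have "\<dots> = (\<Sum>V\<in>?S. \<xi> (nths w V) * ?D V)"
    by (intro sum.cong refl) (simp add: sum.delta)
  finally show ?thesis .
qed

section \<open>The differential equation of the exponential curve\<close>

lemma exp_curve_boxplus_iff:
  fixes \<gamma> :: "'s list \<Rightarrow> 'k::field_char_0 poly"
  shows "exp_curve (\<boxplus>) \<xi> \<gamma> \<longleftrightarrow> \<gamma> [] = 0 \<and> (\<forall>w. poly (\<gamma> w) 0 = 0) \<and>
    (\<forall>w t. w \<noteq> [] \<longrightarrow> poly (pderiv (\<gamma> w)) t =
       (\<Sum>V\<in>Pow {..<length w} - {{}}. \<xi> (nths w V) *
          (\<Prod>c<card V. ((curve_at \<gamma> t)([] := 1)) (nths w (gap (length w) V c)))))"
proof -
  have nil: "(\<forall>t. curve_at \<gamma> t \<in> ncseries) \<longleftrightarrow> \<gamma> [] = 0"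
    by (simp add: ncseries_def curve_at_def poly_all_0_iff_0)
  have zero: "curve_at \<gamma> 0 = zero_series \<longleftrightarrow> (\<forall>w. poly (\<gamma> w) 0 = 0)"
    by (auto simp: fun_eq_iff curve_at_def zero_series_def)
  \<comment> \<open>The row of the empty word is zero, so with \<open>\<gamma> [] = 0\<close> the
    equation holds there and only non-empty words impose conditions.\<close>
  have at_nil: "mat_apply (jacobian ((\<boxplus>) f) zero_series) \<xi> [] = 0" for f :: "'s list \<Rightarrow> 'k"
    by (simp add: mat_apply_def jacobian_boxplus_Nil)
  have ode: "(\<forall>t. curve_at (\<lambda>w. pderiv (\<gamma> w)) t =
          mat_apply (jacobian ((\<boxplus>) (curve_at \<gamma> t)) zero_series) \<xi>) \<longleftrightarrow>
      (\<forall>w t. w \<noteq> [] \<longrightarrow> poly (pderiv (\<gamma> w)) t =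
         mat_apply (jacobian ((\<boxplus>) (curve_at \<gamma> t)) zero_series) \<xi> w)" if "\<gamma> [] = 0"
  proof -
    have nil: "curve_at (\<lambda>w. pderiv (\<gamma> w)) t [] =
        mat_apply (jacobian ((\<boxplus>) (curve_at \<gamma> t)) zero_series) \<xi> []" for t
      using that at_nil by (simp add: curve_at_def)
    show ?thesis
    proof (intro iffI allI impI ext)
      fix w t
      assume "\<forall>t. curve_at (\<lambda>w. pderiv (\<gamma> w)) t =
        mat_apply (jacobian ((\<boxplus>) (curve_at \<gamma> t)) zero_series) \<xi>"
      from fun_cong[OF spec[OF this, of t], of w]
      show "poly (pderiv (\<gamma> w)) t = mat_apply (jacobian ((\<boxplus>) (curve_at \<gamma> t)) zero_series) \<xi> w"
        unfolding curve_at_def .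
    next
      fix t w
      assume "\<forall>w t. w \<noteq> [] \<longrightarrow> poly (pderiv (\<gamma> w)) t =
         mat_apply (jacobian ((\<boxplus>) (curve_at \<gamma> t)) zero_series) \<xi> w"
      then have "curve_at (\<lambda>w. pderiv (\<gamma> w)) t w =
          mat_apply (jacobian ((\<boxplus>) (curve_at \<gamma> t)) zero_series) \<xi> w" if "w \<noteq> []"
        using that unfolding curve_at_def by blast
      with nil show "curve_at (\<lambda>w. pderiv (\<gamma> w)) t w =
          mat_apply (jacobian ((\<boxplus>) (curve_at \<gamma> t)) zero_series) \<xi> w"
        by (cases "w = []") blast+
    qed
  qed
  show ?thesis
    unfolding exp_curve_def nil zero using ode by (auto simp: mat_apply_jacobian_boxplus)
qed

lemma exp_curve_mom_curve:
  fixes \<xi> :: "'s list \<Rightarrow> 'k::field_char_0"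
  shows "exp_curve (\<boxplus>) \<xi> (mom_curve \<xi>)"
proof -
  have "poly (mom_curve \<xi> w) 0 = 0" for w
  proof (cases "w = []")
    case False
    have "mom (\<lambda>v. 0 :: 'k) w = 0"
      unfolding mom_def nc_sum_def
    proof (rule sum.neutral, rule ballI)
      fix P assume P: "P \<in> nc_on {..<length w}"
      have ne: "P \<noteq> {}" using nc_onD(1)[OF P] False by auto
      show "(\<Prod>V\<in>P. 0) = (0 :: 'k)"
        using ne finite_nc_on_elem[OF finite_lessThan P] by (intro prod_zero) auto
    qed
    then show ?thesis using False by (simp add: mom_curve_def poly_mom)
  qed (simp add: mom_curve_def)
  moreover have "mom_curve \<xi> [] = 0" by (simp add: mom_curve_def)
  ultimately show ?thesis
    unfolding exp_curve_boxplus_iff curve_at_mom_curve using poly_pderiv_mom_curve by blast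
qed

text \<open>Every gap of a non-empty \<open>V\<close> is a proper subset of the positions, so the
  derivative of the coordinate \<open>w\<close> depends only on coordinates at shorter
  words.\<close>

lemma exp_curve_boxplus_unique:
  assumes "exp_curve (\<boxplus>) \<xi> \<gamma>" "exp_curve (\<boxplus>) \<xi> \<delta>"
  shows "\<gamma> = \<delta>"
proof
  fix w
  show "\<gamma> w = \<delta> w"
  proof (induction w rule: length_induct)
    case (1 w)
    show ?case
    proof (cases "w = []")
      case True
      then show ?thesis using assms by (simp add: exp_curve_boxplus_iff)
    next
      case False
      have eq: "((curve_at \<gamma> t)([] := 1)) (nths w (gap (length w) V c)) =
          ((curve_at \<delta> t)([] := 1)) (nths w (gap (length w) V c))"
        if V: "V \<in> Pow {..<length w} - {{}}" for t V c
      proof -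
        have "gap (length w) V c \<subset> {..<length w}"
          using V by (auto simp: gap_def)
        then have "length (nths w (gap (length w) V c)) < length w"
          using psubset_card_mono[of "{..<length w}" "gap (length w) V c"]
          by (simp add: length_nths_subset)
        then show ?thesis using "1.IH" by (simp add: curve_at_def)
      qed
      let ?S = "\<lambda>\<gamma> t. \<Sum>V\<in>Pow {..<length w} - {{}}. \<xi> (nths w V) *
          (\<Prod>c<card V. ((curve_at \<gamma> t)([] := 1)) (nths w (gap (length w) V c)))"
      have "poly (pderiv (\<gamma> w)) t = poly (pderiv (\<delta> w)) t" for t
      proof -
        have "?S \<gamma> t = ?S \<delta> t"
          by (intro sum.cong prod.cong arg_cong2[where f = "(*)"] refl eq)
        moreover have "poly (pderiv (\<gamma> w)) t = ?S \<gamma> t"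
          using assms(1) False unfolding exp_curve_boxplus_iff by blast
        moreover have "poly (pderiv (\<delta> w)) t = ?S \<delta> t"
          using assms(2) False unfolding exp_curve_boxplus_iff by blast
        ultimately show ?thesis by simp
      qed
      then have "pderiv (\<gamma> w) = pderiv (\<delta> w)"
        by (auto simp flip: poly_eq_poly_eq_iff)
      \<comment> \<open>In characteristic 0 a polynomial with zero derivative is constant; the
        common initial value makes the constant 0.\<close>
      then have "degree (\<gamma> w - \<delta> w) = 0"
        by (simp add: pderiv_eq_0_iff[symmetric] pderiv_diff)
      then obtain c where c: "\<gamma> w - \<delta> w = [:c:]"
        by (rule degree_eq_zeroE)
      have "poly (\<gamma> w - \<delta> w) 0 = 0"
        using assms by (simp add: exp_curve_boxplus_iff)
      then show ?thesis using c by simp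
    qed
  qed
qed

lemma EXP_boxplus: "EXP (\<boxplus>) \<xi> = (\<lambda>w. if w = [] then 0 else mom \<xi> w)"
proof -
  have "(THE \<gamma>. exp_curve (\<boxplus>) \<xi> \<gamma>) = mom_curve \<xi>"
    using exp_curve_mom_curve exp_curve_boxplus_unique by (intro the_equality) auto
  then show ?thesis
    by (auto simp: EXP_def curve_at_def mom_curve_def poly_mom)
qed

text \<open>\<open>cum f\<close> shows that \<open>f\<close> has a preimage under
  \<open>EXP\<close>, so \<open>LOG\<close> returns one. Its moments are \<open>f\<close>, and
  \<open>R_transform\<close> recovers it from them.\<close>

lemma R_transform_eq_LOG:
  fixes f :: "'s list \<Rightarrow> 'k::field_char_0"
  assumes f: "f \<in> ncseries" and w: "w \<noteq> []"
  shows "R_transform f w = LOG (\<boxplus>) f w"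
proof -
  have "EXP (\<boxplus>) (cum f) = f"
    using f by (auto simp: EXP_boxplus mom_cum ncseries_def)
  moreover have "cum f \<in> ncseries" by (simp add: ncseries_def)
  ultimately have "f \<in> EXP (\<boxplus>) ` ncseries" by (metis imageI)
  then have "EXP (\<boxplus>) (LOG (\<boxplus>) f) = f"
    unfolding LOG_def by (rule f_inv_into_f)
  then have "f v = mom (LOG (\<boxplus>) f) v" if "v \<noteq> []" for v
    using that by (metis EXP_boxplus)
  then show ?thesis using w by (rule R_transform_mom)
qed

section \<open>The differential of the R-transform at 0\<close>

lemma prod_monomials_coeff_1:
  assumes "finite P" "card P \<noteq> 1"
  shows "coeff (\<Prod>V\<in>P. [:0, c V:]) 1 = (0 :: 'k::comm_ring_1)"
proof -
  have "(\<Prod>V\<in>P. [:0, c V:]) = monom (\<Prod>V\<in>P. c V) (card P)"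
    using assms(1)
    by (induction P rule: finite_induct) (simp_all add: monom_altdef one_pCons mult.commute)
  then show ?thesis using assms(2) by simp
qed

lemma dR_eq: "dR w v = (if w = v \<and> w \<noteq> [] then 1 else (0::'k::field_char_0))"
proof (cases "w = []")
  case True
  show ?thesis
    unfolding dR_def jacobian_def
    by (subst partial_deriv_eq_coeff[where p = 0])
      (simp_all add: True R_transform_def boxconv_def zero_series_def)
next
  case False
  let ?n = "length w" and ?N = "NC (length w)"
  let ?c = "\<lambda>V. if nths w V = v then 1 else 0 :: 'k"
  let ?m = "\<lambda>P. coeff_part Moeb w (kreweras ?n P) :: 'k"
  \<comment> \<open>The R-transform along the coordinate \<open>v\<close>: every block gives a
    multiple of the parameter, so a partition contributes only in the degree equal to its number of
    blocks.\<close>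
  let ?p = "\<Sum>P\<in>?N. smult (?m P) (\<Prod>V\<in>P. [:0, ?c V:])"
  have fin: "finite ?N" by (simp add: NC_eq_nc_on finite_nc_on)
  have top: "{{..<?n}} \<in> nc_on {..<?n}"
    using False by (intro top_in_nc_on) auto
  have "dR w v = coeff ?p 1"
    unfolding dR_def jacobian_def
  proof (rule partial_deriv_eq_coeff)
    fix t :: 'k
    have "(zero_series(v := t)) u = t * (if u = v then 1 else 0)" for u
      by (simp add: zero_series_def)
    then show "poly ?p t = R_transform (zero_series(v := t)) w"
      using False by (simp add: R_transform_def boxconv_def coeff_part_def poly_sum poly_prod mult.commute)
  qed (simp add: zero_series_def)
  also have "\<dots> = (\<Sum>P\<in>?N. ?m P * coeff (\<Prod>V\<in>P. [:0, ?c V:]) 1)"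
    by (simp add: coeff_sum)
  also have "\<dots> = (\<Sum>P\<in>{{{..<?n}}}. ?m P * coeff (\<Prod>V\<in>P. [:0, ?c V:]) 1)"
  proof (rule sum.mono_neutral_right[OF fin])
    show "\<forall>P\<in>?N - {{{..<?n}}}. ?m P * coeff (\<Prod>V\<in>P. [:0, ?c V:]) 1 = 0"
    proof
      fix P assume "P \<in> ?N - {{{..<?n}}}"
      then have P: "P \<in> nc_on {..<?n}" "P \<noteq> {{..<?n}}" by (auto simp: NC_eq_nc_on)
      have "card P \<noteq> 1"
      proof
        assume "card P = 1"
        then obtain V where "P = {V}" by (auto simp: card_1_singleton_iff)
        then show False using nc_onD(1)[OF P(1)] P(2) by simp
      qed
      then show "?m P * coeff (\<Prod>V\<in>P. [:0, ?c V:]) 1 = 0"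
        using finite_nc_on_elem[OF _ P(1)] prod_monomials_coeff_1[of P ?c] by simp
    qed
  qed (use top in \<open>simp add: NC_eq_nc_on\<close>)
  also have "\<dots> = ?m {{..<?n}} * ?c {..<?n}" by simp
  also have "?m {{..<?n}} = 1"
  proof -
    have "kreweras ?n {{..<?n}} = (\<lambda>i. {i}) ` {..<?n}"
      using kreweras_eq_kr[of "{{..<?n}}" ?n] kr_top[of ?n] top False by (simp add: NC_eq_nc_on)
    moreover have "Moeb (nths w {i}) = (1::'k)" if "i < ?n" for i
    proof -
      have "length (nths w {i}) = 1" using that by (simp add: length_nths_subset)
      then obtain x where "nths w {i} = [x]" by (auto simp: length_Suc_conv)
      then show ?thesis by (simp add: Moeb_single)
    qed
    ultimately show ?thesis
      by (auto simp: coeff_part_def intro!: prod.neutral)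
  qed
  finally show ?thesis using False by (simp add: nths_all)
qed

theorem proposition5p10:
  shows "lower_unitriangular (dR :: 's::{finite,linorder} list \<Rightarrow> 's list \<Rightarrow> 'k::field_char_0) \<and>
    (\<forall>f\<in>(ncseries :: ('s list \<Rightarrow> 'k) set).
       R_transform f = mat_apply dR (LOG (\<boxplus>) f))"
proof (intro conjI ballI)
  \<comment> \<open>No word precedes itself, so every entry required to vanish is off the
    diagonal.\<close>
  have "(w, w) \<notin> lenlex {(a, b). a < b}" for w :: "'s list"
    by (rule lenlex_irreflexive) simp
  then show "lower_unitriangular (dR :: 's list \<Rightarrow> 's list \<Rightarrow> 'k)"
    by (auto simp: lower_unitriangular_def dR_eq)
next
  fix f :: "'s list \<Rightarrow> 'k" assume f: "f \<in> ncseries"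
  show "R_transform f = mat_apply dR (LOG (\<boxplus>) f)"
  proof
    fix w
    have "mat_apply dR (LOG (\<boxplus>) f) w = (if w = [] then 0 else LOG (\<boxplus>) f w)"
      by (subst mat_apply_superset[where B = "{w}"]) (auto simp: dR_eq split: if_splits)
    moreover have "R_transform f [] = 0" by (simp add: R_transform_def boxconv_def)
    ultimately show "R_transform f w = mat_apply dR (LOG (\<boxplus>) f) w"
      using R_transform_eq_LOG[OF f] by (cases "w = []") auto
  qed
qed

end
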